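(* Let $W$ be the $n\times n$ matrix with $W_{j,k}=e^{2\pi i jk/n}$ and $D$ the diagonal matrix with $D_{k,k}=2\sin(\pi k/n)$, $1\le j,k\le n$. Then the response matrix $\Lambda$ of $\mathcal{P}$ satisfies $\Lambda W=WD$.
   Context: Let $n\ge 2$ be an integer and let $\mathcal{P}\subset\mathbb{C}$ be the closed regular polygon with $2n$ sides, centered at the origin, such that the midpoint of its $j$-th side lies at $e^{i\pi j/n}$ for $1\le j\le 2n$. The even-numbered sides are called nodes: node $j$ ($1\le j\le n$) is side $2j$. The odd-numbered sides are called free edges. Given constants $v_1,\dots,v_n$, let $V$ be the unique continuous function on $\mathcal{P}$ that is harmonic in the interior, equals $v_j$ on side $2j$, and has zero normal derivative on the free edges. The current $I_j$ entering $\mathcal{P}$ through node $j$ is the flux of $-\nabla V$ through side $2j$ into $\mathcal{P}$. The response matrix $\Lambda$ is the $n\times n$ matrix with $\vec I=\Lambda\vec v$, extended complex-linearly to $\mathbb{C}^n$. *)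

theory Defs
  imports "HOL-Analysis.Analysis"
begin

text \<open>Vertices of the regular 2n-gon whose j-th side has midpoint exp(i pi j/n).
  Side j (1 <= j <= 2n) is the closed segment from polyvert n j to polyvert n (j+1);
  indices are effectively taken mod 2n by periodicity of cis.\<close>
definition polyvert :: "nat \<Rightarrow> nat \<Rightarrow> complex" where
  "polyvert n j = complex_of_real (1 / cos (pi / (2 * real n))) *
                  cis (pi * (2 * real j - 1) / (2 * real n))"

definition polygon :: "nat \<Rightarrow> complex set" where
  "polygon n = convex hull (polyvert n ` {1..2*n})"

definition side :: "nat \<Rightarrow> nat \<Rightarrow> complex set" where
  "side n j = closed_segment (polyvert n j) (polyvert n (Suc j))"

definition open_side :: "nat \<Rightarrow> nat \<Rightarrow> complex set" where
  "open_side n j = open_segment (polyvert n j) (polyvert n (Suc j))"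

definition out_normal :: "nat \<Rightarrow> nat \<Rightarrow> complex" where
  "out_normal n j = cis (pi * real j / real n)"

text \<open>Harmonic on an open set: C^2 with vanishing Laplacian. G is the gradient
  (as a complex number Vx + i Vy), H z the derivative of the gradient at z;
  Re (H z 1) = Vxx, Im (H z i) = Vyy.\<close>
definition harmonic_on :: "complex set \<Rightarrow> (complex \<Rightarrow> real) \<Rightarrow> bool" where
  "harmonic_on S V \<longleftrightarrow> open S \<and>
     (\<exists>G H. (\<forall>z\<in>S. (V has_derivative (\<lambda>h. G z \<bullet> h)) (at z) \<and>
                    (G has_derivative H z) (at z) \<and>
                    Re (H z 1) + Im (H z \<i>) = 0) \<and>
            continuous_on S (\<lambda>z. H z 1) \<and> continuous_on S (\<lambda>z. H z \<i>))"

definition mixed_solution ::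
  "nat \<Rightarrow> (nat \<Rightarrow> real) \<Rightarrow> (complex \<Rightarrow> real) \<Rightarrow> (complex \<Rightarrow> complex) \<Rightarrow> bool" where
  "mixed_solution n v V G \<longleftrightarrow>
     continuous_on (polygon n) V \<and>
     harmonic_on (interior (polygon n)) V \<and>
     (\<forall>j\<in>{1..n}. \<forall>z\<in>side n (2*j). V z = v j) \<and>
     (\<forall>z \<in> interior (polygon n) \<union> (\<Union>j\<in>{1..2*n}. open_side n j).
        (V has_derivative (\<lambda>h. G z \<bullet> h)) (at z within polygon n)) \<and>
     (\<forall>j\<in>{1..2*n}. odd j \<longrightarrow> (\<forall>z\<in>open_side n j. G z \<bullet> out_normal n j = 0))"

text \<open>Current entering through node j: flux of -grad V through side 2j into the
  polygon, i.e. integral over the side of grad V dotted with the outward normal,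
  with arclength parametrisation a + t (b - a), ds = |b - a| dt.\<close>
definition current_integrand :: "nat \<Rightarrow> (complex \<Rightarrow> complex) \<Rightarrow> nat \<Rightarrow> real \<Rightarrow> real" where
  "current_integrand n G j t =
     (let a = polyvert n (2*j); b = polyvert n (Suc (2*j))
      in cmod (b - a) * (G (a + complex_of_real t * (b - a)) \<bullet> out_normal n (2*j)))"

definition response_matrix :: "nat \<Rightarrow> (nat \<Rightarrow> nat \<Rightarrow> complex) \<Rightarrow> bool" where
  "response_matrix n Lam \<longleftrightarrow>
     (\<forall>v V G. mixed_solution n v V G \<longrightarrow>
        (\<forall>j\<in>{1..n}. \<exists>I. (current_integrand n G j has_integral I) {0..1} \<and>
              (\<Sum>k=1..n. Lam j k * complex_of_real (v k)) = complex_of_real I))"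

end

theory Submission
  imports Defs "HOL-Complex_Analysis.Complex_Analysis"
begin

text \<open>
  The Schwarz--Christoffel map \<open>g(z) = c \<integral> (1 + w ^ (2 * n)) powr (- 1 / n) dw\<close> carries the unit disc
  to the polygon and the arc around \<open>exp (i * pi * j / n)\<close> to side \<open>j\<close>. On the disc put
  \<open>F m z = \<integral> w ^ (m - 1) * (1 + w ^ (2 * n)) powr (- 1 / 2) dw\<close>, which satisfies
  \<open>F m (exp (i * pi * j / n) * z) = exp (i * pi * j * m / n) * F m z\<close>. For \<open>0 < k < n\<close> the function
  \<open>F k + cnj (F (n - k))\<close> is constant on even arcs, and its harmonic conjugate, which is
  \<open>F k - cnj (F (n - k))\<close> up to a factor, is constant on odd arcs. So both the node potentials and
  the fluxes, which are differences of the conjugate over consecutive odd arcs, are read off at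
  the midpoints of the arcs. By the rotation law they are \<open>exp (2 * i * pi * j * k / n)\<close> and
  \<open>(exp (i * pi * k / n) - exp (- i * pi * k / n)) / i = 2 * sin (pi * k / n)\<close> times it, up to one
  common constant.
\<close>

section \<open>Boundary behaviour of univalent maps of the disc\<close>

text \<open>The obstacle is the set of \<open>2 * n\<close> prevertices, the solutions of
  \<open>z ^ (2 * n) = -1\<close> on the circle, where the integrands are singular. Everywhere else
  derivatives are taken relative to the closed disc or polygon, so that Neumann data and fluxes make
  sense on the sides; at the prevertices only continuity is used. For this reason the primitives are
  power series that converge absolutely on the closed disc. The non-holomorphic functions of the
  overview enter through holomorphic ones: the real part of
  \<open>\<gamma> * F k + cnj \<gamma> * F (n - k)\<close> is that of
  \<open>\<gamma> * (F k + cnj (F (n - k)))\<close>, and its imaginary part is that of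
  \<open>\<gamma> * (F k - cnj (F (n - k)))\<close>. The exponent \<open>- 1 / 2\<close> reflects
  that such a function sends the arcs alternately to vertical and horizontal pieces, with a
  right-angle turn wherever a Dirichlet arc meets a Neumann arc. Since
  \<open>response_matrix\<close> speaks about every mixed solution, one explicit solution for given
  node values already fixes the action of \<open>Lam\<close> on them.\<close>

text \<open>Subtracting \<open>f a * z\<close> leaves a derivative of norm at most \<open>e\<close>
  near \<open>a\<close>. The mean value inequality on the convex interior part turns this into a
  Lipschitz bound, which passes to the closure and so to a boundary point \<open>a\<close>.\<close>

lemma has_field_derivative_within_closed_convex:
  fixes F f :: "complex \<Rightarrow> complex"
  assumes S: "convex S" "closed S" "interior S \<noteq> {}"
    and F: "continuous_on S F" "\<And>z. z \<in> interior S \<Longrightarrow> (F has_field_derivative f z) (at z)"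
    and a: "a \<in> S" "continuous (at a within S) f"
  shows "(F has_field_derivative f a) (at a within S)"
  unfolding has_field_derivative_def has_derivative_within_alt
proof (intro conjI allI impI)
  show "bounded_linear ((*) (f a))" by (rule bounded_linear_mult_right)
  fix e :: real assume e: "e > 0"
  obtain d where d: "d > 0" "\<And>z. z \<in> S \<Longrightarrow> dist z a < d \<Longrightarrow> dist (f z) (f a) < e"
    using a(2) e unfolding continuous_within_eps_delta by blast
  define G where "G = (\<lambda>z. F z - f a * z)"
  define T where "T = ball a d \<inter> interior S"
  have TS: "T \<subseteq> S" using interior_subset unfolding T_def by auto
  have clT: "ball a d \<inter> S \<subseteq> closure T"
  proof -
    have "ball a d \<inter> S \<subseteq> ball a d \<inter> closure (interior S)"
      using convex_closure_interior[OF S(1,3)] closure_subset by blast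
    also have "\<dots> \<subseteq> closure T" unfolding T_def by (rule open_Int_closure_subset) simp
    finally show ?thesis .
  qed
  have "e-lipschitz_on T G"
  proof (rule lipschitz_onI)
    fix x y assume xy: "x \<in> T" "y \<in> T"
    have "norm (G x - G y) \<le> e * norm (x - y)"
    proof (rule field_differentiable_bound[of T G "\<lambda>z. f z - f a"])
      show "convex T" unfolding T_def using S(1) by (intro convex_Int convex_ball convex_interior)
      fix z assume z: "z \<in> T"
      show "(G has_field_derivative f z - f a) (at z within T)"
        unfolding G_def using z
        by (auto simp: T_def intro!: derivative_eq_intros has_field_derivative_at_within[OF F(2)])
      show "norm (f z - f a) \<le> e"
        using z d(2)[of z] TS by (auto simp: T_def dist_norm norm_minus_commute intro: less_imp_le)
    qed (use xy in auto)
    then show "dist (G x) (G y) \<le> e * dist x y" by (simp add: dist_norm)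
  qed (use e in simp)
  moreover have "continuous_on (closure T) G"
    unfolding G_def using closure_minimal[OF TS S(2)]
    by (auto intro!: continuous_intros continuous_on_subset[OF F(1)])
  ultimately have lip: "e-lipschitz_on (closure T) G" by (rule lipschitz_on_closure)
  show "\<exists>d>0. \<forall>y\<in>S. norm (y - a) < d \<longrightarrow> norm (F y - F a - f a * (y - a)) \<le> e * norm (y - a)"
  proof (intro exI[of _ d] conjI ballI impI)
    fix y assume y: "y \<in> S" "norm (y - a) < d"
    have "y \<in> closure T" "a \<in> closure T"
      using clT y a(1) d(1) by (auto simp: dist_norm norm_minus_commute)
    from lipschitz_onD[OF lip this] show "norm (F y - F a - f a * (y - a)) \<le> e * norm (y - a)"
      by (simp add: G_def dist_norm algebra_simps)
  qed (use d in simp)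
qed

text \<open>Fill-in principle: a point of the image outside \<open>P\<close> could be separated from \<open>P\<close>, but linear
  functionals are extremal at images of boundary points because the image of the open ball is open.
  Conversely that image is open and closed in the connected set \<open>interior P\<close>.\<close>

lemma image_cball_eq_convex:
  fixes f :: "'a::euclidean_space \<Rightarrow> 'a"
  assumes r: "r > 0" and f: "continuous_on (cball a r) f" "inj_on f (cball a r)"
    and P: "convex P" "closed P" and bd: "f ` sphere a r \<subseteq> frontier P"
  shows "f ` ball a r = interior P" "f ` cball a r = P"
proof -
  have op: "open (f ` ball a r)"
    by (rule invariance_of_domain)
       (auto intro: continuous_on_subset[OF f(1)] inj_on_subset[OF f(2)])
  have K: "compact (f ` cball a r)" by (intro compact_continuous_image f compact_cball)
  have bdP: "f ` sphere a r \<subseteq> P" using bd P(2) by (auto simp: frontier_def)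
  have sub: "f ` cball a r \<subseteq> P"
  proof
    fix y assume y: "y \<in> f ` cball a r"
    show "y \<in> P"
    proof (rule ccontr)
      assume "y \<notin> P"
      then obtain u b where ub: "u \<bullet> y < b" "\<And>x. x \<in> P \<Longrightarrow> u \<bullet> x > b"
        using separating_hyperplane_closed_point[OF P] by blast
      \<comment> \<open>The minimum of \<open>u\<close> lies strictly on the wrong side of the
        hyperplane, so \<open>p\<close> is not the image of a boundary point, and openness of the
        image leaves room to move further against \<open>u\<close>.\<close>
      obtain p where p: "p \<in> f ` cball a r" "\<And>x. x \<in> f ` cball a r \<Longrightarrow> u \<bullet> p \<le> u \<bullet> x"
        using continuous_attains_inf[OF K, of "\<lambda>x. u \<bullet> x"] y continuous_on_inner[OF continuous_on_const continuous_on_id]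
        by blast
      have pb: "u \<bullet> p < b" using p(2)[OF y] ub(1) by simp
      then have "p \<notin> f ` sphere a r" using ub(2) bdP by force
      then have "p \<in> f ` ball a r" using p(1) by (force simp: image_iff)
      then obtain e where e: "e > 0" "cball p e \<subseteq> f ` ball a r"
        using op open_contains_cball by metis
      have "f ` sphere a r \<noteq> {}" using r by simp
      then obtain w where "w \<in> P" using bdP by blast
      then have "u \<noteq> 0" using ub(2)[of w] ub(1) by auto
      define q where "q = p - (e / norm u) *\<^sub>R u"
      have "q \<in> cball p e" using e(1) by (simp add: q_def dist_norm)
      then have "q \<in> f ` cball a r" using e(2) by force
      from p(2)[OF this] have "u \<bullet> p \<le> u \<bullet> q" .
      moreover have "u \<bullet> q = u \<bullet> p - e * norm u"
        using \<open>u \<noteq> 0\<close> by (simp add: q_def inner_diff_right dot_square_norm power2_eq_square)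
      moreover have "e * norm u > 0" using e(1) \<open>u \<noteq> 0\<close> by simp
      ultimately show False by simp
    qed
  qed
  have split: "f ` cball a r = f ` ball a r \<union> f ` sphere a r"
    unfolding image_Un[symmetric] by (rule arg_cong[where f = "image f"]) auto
  have int: "f ` ball a r \<subseteq> interior P"
    using sub op by (intro interior_maximal) (auto simp: split)
  \<comment> \<open>Boundary points land in the frontier, which misses \<open>interior P\<close>;
    the open image is therefore the trace of a compact set, hence relatively closed.\<close>
  have eq: "f ` ball a r = f ` cball a r \<inter> interior P"
    using int bd by (auto simp: split frontier_def)
  have "openin (top_of_set (interior P)) (f ` ball a r)"
    using op int by (simp add: openin_open_eq)
  moreover have "closedin (top_of_set (interior P)) (f ` ball a r)"
    using K unfolding eq by (metis closedin_closed_Int compact_imp_closed inf_commute)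
  moreover have "connected (interior P)" using P(1) by (intro convex_connected convex_interior)
  moreover have ne: "f ` ball a r \<noteq> {}" using r by simp
  ultimately show I: "f ` ball a r = interior P" using connected_clopen by blast
  have "P = closure (interior P)"
    using convex_closure_interior[OF P(1)] ne I P(2) by simp
  also have "\<dots> \<subseteq> f ` cball a r"
    unfolding I[symmetric] using K by (intro closure_minimal) (auto intro: compact_imp_closed)
  finally show "f ` cball a r = P" using sub by blast
qed

text \<open>Along the chord from \<open>x\<close> to \<open>y\<close>, the component of
  \<open>f\<close> in direction \<open>y - x\<close> has derivative \<open>Re f'\<close> times the
  squared chord length. The open chord lies in the open ball, so injectivity extends to the
  sphere.\<close>

lemma inj_on_cball_Re_deriv_pos:
  fixes f :: "complex \<Rightarrow> complex"
  assumes f: "continuous_on (cball a r) f"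
    and d: "\<And>z. z \<in> ball a r \<Longrightarrow> (f has_field_derivative f' z) (at z)"
    and pos: "\<And>z. z \<in> ball a r \<Longrightarrow> Re (f' z) > 0"
  shows "inj_on f (cball a r)"
proof (rule inj_onI, rule ccontr)
  fix x y assume xy: "x \<in> cball a r" "y \<in> cball a r" "f x = f y" "x \<noteq> y"
  define p where "p = (\<lambda>t. x + of_real t * (y - x))"
  define h where "h = (\<lambda>t. Re (f (p t) * cnj (y - x)))"
  have p: "p t \<in> cball a r" if "t \<in> {0..1}" for t
    using convexD_alt[OF convex_cball xy(1,2), of t] that
    by (simp add: p_def scaleR_conv_of_real algebra_simps)
  have pi: "p t \<in> ball a r" if "0 < t" "t < 1" for t
  proof -
    have "p t \<in> open_segment x y"
      using that xy(4) by (auto simp: in_segment p_def scaleR_conv_of_real algebra_simps intro!: exI[of _ t])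
    then show ?thesis using xy(1,2) by (metis dist_decreases_open_segment mem_ball mem_cball dist_commute less_le_trans max_def order_le_less_trans not_le less_eq_real_def)
  qed
  have "h 0 < h 1"
  proof (rule DERIV_pos_imp_increasing_open[where f = h and a = 0 and b = 1])
    show "continuous_on {0..1} h"
      unfolding h_def by (intro continuous_intros continuous_on_compose2[OF f]) (auto simp: p_def intro!: continuous_intros, insert p, auto simp: p_def)
    fix t :: real assume t: "0 < t" "t < 1"
    have "(f has_field_derivative f' (p t)) (at (p t))" using d pi t by blast
    moreover have "(p has_vector_derivative (y - x)) (at t)"
      unfolding p_def by (auto intro!: derivative_eq_intros)
    ultimately have "((f \<circ> p) has_vector_derivative (y - x) * f' (p t)) (at t)"
      by (rule field_vector_diff_chain_at[rotated])
    then have "((\<lambda>t. f (p t) * cnj (y - x)) has_vector_derivative (y - x) * f' (p t) * cnj (y - x)) (at t)"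
      unfolding o_def by (rule has_vector_derivative_mult_left)
    then have "(h has_vector_derivative Re ((y - x) * f' (p t) * cnj (y - x))) (at t)"
      unfolding h_def by (rule bounded_linear.has_vector_derivative[OF bounded_linear_Re])
    then have der: "DERIV h t :> Re ((y - x) * f' (p t) * cnj (y - x))"
      by (simp add: has_real_derivative_iff_has_vector_derivative)
    have eq: "(y - x) * f' (p t) * cnj (y - x) = of_real ((cmod (y - x))\<^sup>2) * f' (p t)"
      by (subst complex_norm_square) (simp add: mult_ac)
    have "Re ((y - x) * f' (p t) * cnj (y - x)) > 0"
      unfolding eq using pos[OF pi[OF t]] xy(4) by (simp del: of_real_power)
    with der show "\<exists>y. DERIV h t :> y \<and> y > 0" by blast
  qed simp
  then show False using xy(3) by (simp add: h_def p_def)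
qed

section \<open>Schwarz--Christoffel primitives\<close>

text \<open>Termwise integration of the binomial series of
  \<open>w ^ (m - 1) * (1 + w ^ (2 * n)) powr (- \<alpha>)\<close> produces these coefficients;
  \<open>sc_prim\<close> pulls out the common factor \<open>z ^ m\<close>.\<close>

definition sc_coeff :: "real \<Rightarrow> nat \<Rightarrow> nat \<Rightarrow> nat \<Rightarrow> complex" where
  "sc_coeff \<alpha> n m j = (- complex_of_real \<alpha> gchoose j) / of_nat (2 * n * j + m)"

definition sc_prim :: "real \<Rightarrow> nat \<Rightarrow> nat \<Rightarrow> complex \<Rightarrow> complex" where
  "sc_prim \<alpha> n m z = z ^ m * (\<Sum>j. sc_coeff \<alpha> n m j * (z ^ (2 * n)) ^ j)"

definition sc_deriv :: "real \<Rightarrow> nat \<Rightarrow> nat \<Rightarrow> complex \<Rightarrow> complex" where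
  "sc_deriv \<alpha> n m z = z ^ (m - 1) * (1 + z ^ (2 * n)) powr (- of_real \<alpha>)"

text \<open>The binomial coefficients are bounded by a multiple of
  \<open>j powr (\<alpha> - 1)\<close>, and the denominator gained by integration adds the power
  needed for absolute convergence on the unit circle.\<close>

lemma summable_sc_coeff:
  assumes "0 < \<alpha>" "\<alpha> < 1" "n > 0" "m > 0"
  shows "summable (\<lambda>j. norm (sc_coeff \<alpha> n m j))"
proof -
  let ?a = "- complex_of_real \<alpha>"
  have "Bseq (\<lambda>j. (?a gchoose j) / ((-1)^j / exp ((?a + 1) * of_real (ln (real j)))))"
    by (rule convergent_imp_Bseq, rule convergentI, rule gbinomial_asymptotic)
  then obtain B where B: "B > 0"
    "\<And>j. norm ((?a gchoose j) / ((-1)^j / exp ((?a + 1) * of_real (ln (real j))))) \<le> B"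
    by (rule BseqE) blast
  show ?thesis
  proof (rule summable_comparison_test_ev)
    show "\<forall>\<^sub>F j in sequentially. norm (norm (sc_coeff \<alpha> n m j)) \<le> B * real j powr (\<alpha> - 2)"
      using eventually_gt_at_top[of 0]
    proof eventually_elim
      case (elim j)
      have "norm (exp ((?a + 1) * of_real (ln (real j)))) = real j powr (1 - \<alpha>)"
        using elim by (simp add: norm_exp_eq_Re powr_def algebra_simps)
      with B(2)[of j] have "norm (?a gchoose j) * real j powr (1 - \<alpha>) \<le> B"
        by (simp add: norm_divide norm_mult norm_power)
      then have "norm (?a gchoose j) \<le> B * real j powr (\<alpha> - 1)"
        using elim by (simp add: powr_diff field_simps)
      moreover have "real j \<le> real (2 * n * j + m)"
      proof -
        have "1 * j \<le> 2 * n * j" using assms(3) by (intro mult_right_mono) auto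
        then show ?thesis by linarith
      qed
      ultimately have "norm (?a gchoose j) / real (2 * n * j + m) \<le> B * real j powr (\<alpha> - 1) / real j"
        using elim B(1) by (intro frac_le) auto
      also have "\<dots> = B * real j powr (\<alpha> - 2)"
        using elim by (simp add: powr_diff power2_eq_square)
      finally show ?case unfolding sc_coeff_def norm_divide norm_of_nat by simp
    qed
    show "summable (\<lambda>j. B * real j powr (\<alpha> - 2))"
      using assms(2) by (intro summable_mult) (simp add: summable_real_powr_iff)
  qed
qed

lemma continuous_on_sc_prim:
  assumes "0 < \<alpha>" "\<alpha> < 1" "n > 0" "m > 0"
  shows "continuous_on (cball 0 1) (sc_prim \<alpha> n m)"
proof -
  have "uniform_limit (cball 0 1) (\<lambda>N z. \<Sum>j<N. sc_coeff \<alpha> n m j * (z ^ (2 * n)) ^ j)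
          (\<lambda>z. \<Sum>j. sc_coeff \<alpha> n m j * (z ^ (2 * n)) ^ j) sequentially"
  proof (rule Weierstrass_m_test)
    fix j and z :: complex assume "z \<in> cball 0 1"
    then have "norm ((z ^ (2 * n)) ^ j) \<le> 1"
      by (simp add: norm_power power_le_one)
    then show "norm (sc_coeff \<alpha> n m j * (z ^ (2 * n)) ^ j) \<le> norm (sc_coeff \<alpha> n m j)"
      by (simp add: norm_mult mult_left_le)
  qed (rule summable_sc_coeff[OF assms])
  then have "continuous_on (cball 0 1) (\<lambda>z. \<Sum>j. sc_coeff \<alpha> n m j * (z ^ (2 * n)) ^ j)"
    by (rule uniform_limit_theorem[rotated]) (auto intro!: continuous_intros always_eventually)
  then show ?thesis unfolding sc_prim_def[abs_def] by (intro continuous_intros)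
qed

text \<open>With \<open>Q\<close> the series in \<open>w = z ^ (2 * n)\<close>, passing to
  \<open>m * Q + 2 * n * w * Q'\<close> multiplies the \<open>j\<close>-th coefficient by
  \<open>2 * n * j + m\<close>. This cancels the denominator and leaves the binomial series.\<close>

lemma has_field_derivative_sc_prim_interior:
  assumes "0 < \<alpha>" "\<alpha> < 1" "n > 0" "m > 0" and z: "norm z < 1"
  shows "(sc_prim \<alpha> n m has_field_derivative sc_deriv \<alpha> n m z) (at z)"
proof -
  define c where "c = sc_coeff \<alpha> n m"
  define Q where "Q = (\<lambda>w. \<Sum>j. c j * w ^ j)"
  define Q' where "Q' = (\<lambda>w. \<Sum>j. diffs c j * w ^ j)"
  define w where "w = z ^ (2 * n)"
  have w: "norm w < 1" using z assms(3) by (simp add: w_def norm_power power_less_one_iff)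
  have sm: "summable (\<lambda>j. c j * 1 ^ j)"
    using summable_norm_cancel[OF summable_sc_coeff[OF assms(1-4)]] by (simp add: c_def)
  have Q: "(Q has_field_derivative Q' w) (at w)"
    unfolding Q_def Q'_def by (rule termdiffs_strong[OF sm]) (use w in simp)
  have sQ: "(\<lambda>j. c j * w ^ j) sums Q w"
    unfolding Q_def by (rule summable_sums, rule powser_inside[OF sm]) (use w in simp)
  have "summable (\<lambda>j. diffs c j * w ^ j)"
    by (rule termdiff_converges[where K = 1]) (use w powser_inside[OF sm] in auto)
  from diffs_equiv[OF this] have "(\<lambda>j. w * (of_nat j * c j * w ^ (j - Suc 0))) sums (w * Q' w)"
    unfolding Q'_def by (rule sums_mult)
  moreover have "w * (of_nat j * c j * w ^ (j - Suc 0)) = of_nat j * (c j * w ^ j)" for j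
    by (cases j) (simp_all add: mult_ac)
  ultimately have "(\<lambda>j. of_nat j * (c j * w ^ j)) sums (w * Q' w)" by simp
  from sums_add[OF sums_mult[OF sQ, of "of_nat m"] sums_mult[OF this, of "of_nat (2 * n)"]]
  have "(\<lambda>j. of_nat m * (c j * w ^ j) + of_nat (2 * n) * (of_nat j * (c j * w ^ j))) sums
    (of_nat m * Q w + of_nat (2 * n) * (w * Q' w))" .
  moreover have "of_nat m * (c j * w ^ j) + of_nat (2 * n) * (of_nat j * (c j * w ^ j)) =
    (- of_real \<alpha> gchoose j) * w ^ j" for j
  proof -
    have "of_nat m * (c j * w ^ j) + of_nat (2 * n) * (of_nat j * (c j * w ^ j)) =
      of_nat (2 * n * j + m) * c j * w ^ j" by (simp add: algebra_simps)
    also have "of_nat (2 * n * j + m) * c j = (- of_real \<alpha> gchoose j)"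
      unfolding c_def sc_coeff_def using assms(4) by (simp del: of_nat_add of_nat_mult)
    finally show ?thesis .
  qed
  ultimately have "(\<lambda>j. (- of_real \<alpha> gchoose j) * w ^ j) sums
    (of_nat m * Q w + of_nat (2 * n) * (w * Q' w))" by simp
  from sums_unique2[OF this gen_binomial_complex[OF w]]
  have eq: "of_nat m * Q w + of_nat (2 * n) * (w * Q' w) = (1 + w) powr (- of_real \<alpha>)" .
  have "((\<lambda>z. z ^ m * Q (z ^ (2 * n))) has_field_derivative
    of_nat m * z ^ (m - 1) * Q w + (Q' w * (of_nat (2 * n) * z ^ (2 * n - 1))) * z ^ m) (at z)"
    using Q unfolding w_def
    by (auto intro!: derivative_eq_intros DERIV_chain2[of Q])
  moreover have "of_nat m * z ^ (m - 1) * Q w + (Q' w * (of_nat (2 * n) * z ^ (2 * n - 1))) * z ^ m =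
     z ^ (m - 1) * (of_nat m * Q w + of_nat (2 * n) * (w * Q' w))"
    using assms(3,4) unfolding w_def
    by (cases m; cases "2 * n") (auto simp: algebra_simps)
  ultimately have "((\<lambda>z. z ^ m * Q (z ^ (2 * n))) has_field_derivative
    z ^ (m - 1) * (1 + w) powr (- of_real \<alpha>)) (at z)"
    by (simp only: eq)
  then show ?thesis
    unfolding sc_prim_def[abs_def] sc_deriv_def Q_def c_def w_def .
qed

text \<open>The closed unit disc shifted by 1 lies in the half-plane of nonnegative real part, which
  meets the branch cut only at 0. The principal power thus stays continuous up to the circle off the
  prevertices.\<close>

lemma one_plus_notin_nonpos_Reals:
  fixes w :: complex
  assumes "norm w \<le> 1" "w \<noteq> -1"
  shows "1 + w \<notin> \<real>\<^sub>\<le>\<^sub>0"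
proof
  assume "1 + w \<in> \<real>\<^sub>\<le>\<^sub>0"
  then have "Re w \<le> -1" "Im w = 0" by (auto simp: complex_nonpos_Reals_iff)
  moreover have "\<bar>Re w\<bar> \<le> 1" using assms(1) abs_Re_le_cmod[of w] by linarith
  ultimately have "w = -1" by (auto simp: complex_eq_iff)
  with assms(2) show False by simp
qed

lemma has_field_derivative_sc_prim:
  assumes "0 < \<alpha>" "\<alpha> < 1" "n > 0" "m > 0" and z: "z \<in> cball 0 1" "z ^ (2 * n) \<noteq> -1"
  shows "(sc_prim \<alpha> n m has_field_derivative sc_deriv \<alpha> n m z) (at z within cball 0 1)"
proof (rule has_field_derivative_within_closed_convex)
  have "norm (z ^ (2 * n)) \<le> 1" using z(1) by (simp add: norm_power power_le_one)
  from one_plus_notin_nonpos_Reals[OF this z(2)]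
  have "isCont (sc_deriv \<alpha> n m) z"
    unfolding sc_deriv_def[abs_def] by (intro continuous_intros) auto
  then show "continuous (at z within cball 0 1) (sc_deriv \<alpha> n m)"
    by (rule continuous_at_imp_continuous_at_within)
qed (use assms in \<open>auto intro: continuous_on_sc_prim has_field_derivative_sc_prim_interior\<close>)

section \<open>Behaviour along the boundary arcs of the disc\<close>

text \<open>The angle is rescaled so that arc \<open>j\<close> is
  \<open>\<bar>\<phi>\<bar> \<le> pi / 2\<close> and
  \<open>1 + z ^ (2 * n) = 2 * cos \<phi> * cis \<phi>\<close> has argument \<open>\<phi>\<close>
  inside the arc.\<close>

definition arc_pt :: "nat \<Rightarrow> nat \<Rightarrow> real \<Rightarrow> complex" where
  "arc_pt n j \<phi> = cis ((pi * real j + \<phi>) / real n)"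

lemma norm_arc_pt [simp]: "norm (arc_pt n j \<phi>) = 1"
  by (simp add: arc_pt_def)

lemma arc_pt_power: "arc_pt n j \<phi> ^ m = cis (real m * (pi * real j + \<phi>) / real n)"
  by (simp add: arc_pt_def Complex.DeMoivre)

lemma arc_pt_power_2n:
  assumes "n > 0"
  shows "arc_pt n j \<phi> ^ (2 * n) = cis (2 * \<phi>)"
proof -
  have "arc_pt n j \<phi> ^ (2 * n) = cis (2 * pi * real j + 2 * \<phi>)"
    using assms unfolding arc_pt_power by (intro arg_cong[where f = cis]) (simp add: field_simps)
  also have "\<dots> = cis (2 * \<phi>)"
    by (simp add: cis_mult[symmetric] cis_multiple_2pi)
  finally show ?thesis .
qed

lemma one_plus_cis_double: "1 + cis (2 * \<phi>) = of_real (2 * cos \<phi>) * cis \<phi>"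
  by (simp add: complex_eq_iff cos_double_cos[of \<phi>] sin_double[of \<phi>] power2_eq_square)

lemma powr_of_real_mult_cis:
  assumes "r > 0" "- pi < \<phi>" "\<phi> \<le> pi"
  shows "(of_real r * cis \<phi>) powr of_real a = of_real (r powr a) * cis (a * \<phi>)"
proof -
  have "Ln (of_real r * cis \<phi>) = of_real (ln r) + \<i> * of_real \<phi>"
  proof (rule Ln_unique)
    show "exp (complex_of_real (ln r) + \<i> * complex_of_real \<phi>) = complex_of_real r * cis \<phi>"
      using assms(1) by (simp add: exp_add cis_conv_exp exp_of_real)
  qed (use assms in auto)
  moreover have "of_real r * cis \<phi> \<noteq> 0" using assms(1) by simp
  ultimately have "(of_real r * cis \<phi>) powr of_real a = exp (of_real a * (of_real (ln r) + \<i> * of_real \<phi>))"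
    by (simp add: powr_def)
  also have "\<dots> = exp (of_real (a * ln r)) * exp (\<i> * of_real (a * \<phi>))"
    by (simp add: exp_add[symmetric] algebra_simps)
  also have "\<dots> = of_real (r powr a) * cis (a * \<phi>)"
    using assms(1) by (simp add: powr_def cis_conv_exp exp_of_real[symmetric])
  finally show ?thesis .
qed

lemma cos_gt_zero_abs: "\<bar>\<phi>\<bar> < pi / 2 \<Longrightarrow> cos \<phi> > 0"
  by (rule cos_gt_zero_pi) auto

lemma arc_pt_power_2n_neq:
  assumes "n > 0" "\<bar>\<phi>\<bar> < pi / 2"
  shows "arc_pt n j \<phi> ^ (2 * n) \<noteq> -1"
proof
  assume "arc_pt n j \<phi> ^ (2 * n) = -1"
  then have "of_real (2 * cos \<phi>) * cis \<phi> = 0"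
    unfolding arc_pt_power_2n[OF assms(1)] one_plus_cis_double[symmetric] by simp
  then show False using cos_gt_zero_abs[OF assms(2)] by simp
qed

text \<open>The extra factor \<open>arc_pt n j \<phi>\<close> is there because the derivative along
  the arc is \<open>\<i> / n * z * F' z\<close>. The argument has slope
  \<open>m / n - \<alpha>\<close> in \<open>\<phi>\<close>: zero for \<open>m = 1\<close>,
  \<open>\<alpha> = 1 / n\<close>, and opposite for \<open>m = k\<close> and
  \<open>m = n - k\<close> with \<open>\<alpha> = 1 / 2\<close>.\<close>

lemma sc_deriv_arc_pt:
  assumes "n > 0" "m > 0" "\<bar>\<phi>\<bar> < pi / 2"
  shows "arc_pt n j \<phi> * sc_deriv \<alpha> n m (arc_pt n j \<phi>) =
    of_real ((2 * cos \<phi>) powr (- \<alpha>)) * cis (real m * (pi * real j + \<phi>) / real n - \<alpha> * \<phi>)"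
proof -
  have c: "2 * cos \<phi> > 0" using cos_gt_zero_abs[OF assms(3)] by simp
  have "arc_pt n j \<phi> * sc_deriv \<alpha> n m (arc_pt n j \<phi>) =
    arc_pt n j \<phi> ^ m * (of_real (2 * cos \<phi>) * cis \<phi>) powr (of_real (- \<alpha>))"
    unfolding sc_deriv_def arc_pt_power_2n[OF assms(1)] one_plus_cis_double
    using assms(2) by (cases m) auto
  also have "(of_real (2 * cos \<phi>) * cis \<phi>) powr (of_real (- \<alpha>)) =
    of_real ((2 * cos \<phi>) powr (- \<alpha>)) * cis (- \<alpha> * \<phi>)"
    using assms(3) by (intro powr_of_real_mult_cis c) auto
  finally show ?thesis
    by (simp add: arc_pt_power cis_mult mult_ac)
qed

lemma has_vector_derivative_arc_pt:
  "(arc_pt n j has_vector_derivative \<i> / of_nat n * arc_pt n j \<phi>) (at \<phi>)"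
proof -
  have "((\<lambda>\<phi>. \<i> * of_real ((pi * real j + \<phi>) / real n)) has_vector_derivative \<i> * of_real (1 / real n)) (at \<phi>)"
    by (cases "n = 0") (auto intro!: derivative_eq_intros has_vector_derivative_mult_right has_vector_derivative_of_real simp: field_simps)
  from field_vector_diff_chain_at[OF this DERIV_exp]
  show ?thesis by (simp add: o_def arc_pt_def[abs_def] cis_conv_exp)
qed

lemma continuous_on_arc_pt [continuous_intros]: "continuous_on S (arc_pt n j)"
  using has_vector_derivative_arc_pt
  by (meson continuous_at_imp_continuous_on has_vector_derivative_continuous)

lemma has_vector_derivative_along_arc:
  assumes "(F has_field_derivative d) (at (arc_pt n j \<phi>) within cball 0 1)"
  shows "((\<lambda>\<phi>. F (arc_pt n j \<phi>)) has_vector_derivative \<i> / of_nat n * (arc_pt n j \<phi> * d)) (at \<phi>)"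
proof -
  have "(F has_field_derivative d) (at (arc_pt n j \<phi>) within range (arc_pt n j))"
    by (rule has_field_derivative_subset[OF assms]) auto
  from field_vector_diff_chain_within[OF has_vector_derivative_arc_pt this]
  show ?thesis by (simp add: o_def mult_ac)
qed

lemma arc_pt_center_power_2n [simp]: "n > 0 \<Longrightarrow> arc_pt n j 0 ^ (2 * n) = 1"
  by (simp add: arc_pt_power_2n)

lemma sc_prim_arc_center:
  assumes "n > 0"
  shows "sc_prim \<alpha> n m (arc_pt n j 0) = cis (pi * real j * real m / real n) * sc_prim \<alpha> n m 1"
  unfolding sc_prim_def arc_pt_center_power_2n[OF assms] by (simp add: arc_pt_power mult_ac)

text \<open>On the radius from 0 to 1 the derivative is real and positive. Positivity later allows
  division by these values.\<close>

lemma sc_prim_1_pos: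
  assumes "0 < \<alpha>" "\<alpha> < 1" "n > 0" "m > 0"
  obtains c where "c > 0" "sc_prim \<alpha> n m 1 = of_real c"
proof -
  have der: "((\<lambda>t. sc_prim \<alpha> n m (of_real t)) has_vector_derivative
      of_real (t ^ (m - 1) * (1 + t ^ (2 * n)) powr (- \<alpha>))) (at t)" if t: "0 < t" "t < 1" for t
  proof -
    have "((\<lambda>t. sc_prim \<alpha> n m (of_real t)) has_vector_derivative 1 * sc_deriv \<alpha> n m (of_real t)) (at t)"
    proof -
      have "(complex_of_real has_vector_derivative of_real 1) (at t)"
        by (intro has_vector_derivative_of_real) (auto intro!: derivative_eq_intros)
      moreover have "(sc_prim \<alpha> n m has_field_derivative sc_deriv \<alpha> n m (of_real t)) (at (of_real t))"
        using has_field_derivative_sc_prim_interior[OF assms, of "of_real t"] t by simp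
      ultimately show ?thesis
        using field_vector_diff_chain_at[of of_real "of_real 1" t] by (simp add: o_def)
    qed
    moreover have "0 \<le> t ^ (2 * n)" using t by simp
    then have "(1 + complex_of_real t ^ (2 * n)) powr - of_real \<alpha> = of_real ((1 + t ^ (2 * n)) powr (- \<alpha>))"
      using powr_of_real[of "1 + t ^ (2 * n)" "- \<alpha>"] by simp
    ultimately show ?thesis unfolding sc_deriv_def by simp
  qed
  have cont: "continuous_on {0..1} (\<lambda>t. sc_prim \<alpha> n m (of_real t))"
    by (rule continuous_on_compose2[OF continuous_on_sc_prim[OF assms]])
       (auto intro!: continuous_intros)
  have "Re (sc_prim \<alpha> n m (of_real 0)) < Re (sc_prim \<alpha> n m (of_real 1))"
  proof (rule DERIV_pos_imp_increasing_open[where f = "\<lambda>t. Re (sc_prim \<alpha> n m (of_real t))"])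
    fix t :: real assume t: "0 < t" "t < 1"
    have "0 \<le> t ^ (2 * n)" using t by simp
    then have "1 + t ^ (2 * n) \<noteq> 0" by linarith
    then have "t ^ (m - 1) * (1 + t ^ (2 * n)) powr (- \<alpha>) > 0" using t by (intro mult_pos_pos) auto
    moreover have "DERIV (\<lambda>t. Re (sc_prim \<alpha> n m (of_real t))) t :> t ^ (m - 1) * (1 + t ^ (2 * n)) powr (- \<alpha>)"
      using bounded_linear.has_vector_derivative[OF bounded_linear_Re der[OF t]]
      by (simp add: has_real_derivative_iff_has_vector_derivative)
    ultimately show "\<exists>y. DERIV (\<lambda>t. Re (sc_prim \<alpha> n m (of_real t))) t :> y \<and> 0 < y" by blast
  qed (use cont in \<open>auto intro: continuous_intros\<close>)
  moreover have "Im (sc_prim \<alpha> n m (of_real 1)) = Im (sc_prim \<alpha> n m (of_real 0))"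
  proof (rule DERIV_isconst_end[where f = "\<lambda>t. Im (sc_prim \<alpha> n m (of_real t))"])
    fix t :: real assume t: "0 < t" "t < 1"
    show "DERIV (\<lambda>t. Im (sc_prim \<alpha> n m (of_real t))) t :> 0"
      using bounded_linear.has_vector_derivative[OF bounded_linear_Im der[OF t]]
      by (simp add: has_real_derivative_iff_has_vector_derivative)
  qed (use cont in \<open>auto intro: continuous_intros\<close>)
  moreover have "sc_prim \<alpha> n m 0 = 0" using assms(4) by (simp add: sc_prim_def)
  ultimately show ?thesis
    by (intro that[of "Re (sc_prim \<alpha> n m 1)"]) (auto simp: complex_eq_iff)
qed

lemma sphere_arc_pt:
  assumes "n > 0" "z \<in> sphere 0 1"
  obtains j \<phi> where "j \<in> {1..2*n}" "\<bar>\<phi>\<bar> \<le> pi / 2" "z = arc_pt n j \<phi>"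
proof -
  define t where "t = Arg2pi z"
  have t: "0 \<le> t" "t < 2 * pi" "z = cis t"
    using Arg2pi[of z] assms(2) by (auto simp: t_def cis_conv_exp is_Arg_def)
  \<comment> \<open>Rounding to the nearest integer puts the point within half a step of an arc
    centre.\<close>
  define k where "k = nat \<lfloor>real n * t / pi + 1 / 2\<rfloor>"
  define \<phi> where "\<phi> = real n * t - pi * real k"
  have "0 \<le> real n * t / pi" using t by simp
  then have k: "real k \<le> real n * t / pi + 1 / 2" "real n * t / pi + 1 / 2 < real k + 1"
    unfolding k_def by linarith+
  have "pi * real k \<le> real n * t + pi / 2" "real n * t + pi / 2 < pi * real k + pi"
    using mult_left_mono[OF k(1), of pi] mult_strict_left_mono[OF k(2), of pi]
    by (simp_all add: distrib_left)
  then have \<phi>: "\<bar>\<phi>\<bar> \<le> pi / 2" unfolding \<phi>_def by linarith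
  have zk: "z = arc_pt n k \<phi>" using assms(1) t(3) by (simp add: arc_pt_def \<phi>_def)
  have "real n * t / pi < real n * (2 * pi) / pi"
    using t(2) assms(1) by (intro divide_strict_right_mono mult_strict_left_mono) auto
  then have "real k < 2 * real n + 1 / 2 + 1 / 2" using k(1) by simp
  then have k2: "k \<le> 2 * n" by linarith
  show ?thesis
  \<comment> \<open>Arcs are numbered from 1, so the arc around the point 1 appears as number
    \<open>2 * n\<close>.\<close>
  proof (cases "k = 0")
    case True
    have "arc_pt n (2 * n) \<phi> = cis (2 * pi + \<phi> / real n)"
      using assms(1) by (simp add: arc_pt_def add_divide_distrib mult.commute)
    also have "\<dots> = arc_pt n k \<phi>" by (simp add: True arc_pt_def cis_mult[symmetric])
    finally show ?thesis using that[of "2 * n" \<phi>] \<phi> zk assms(1) by simp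
  next
    case False
    then show ?thesis using that[of k \<phi>] \<phi> zk k2 by simp
  qed
qed

section \<open>Geometry of the polygon\<close>

text \<open>The apothem is 1 because the side midpoints lie on the unit circle; half the side length
  is then this tangent.\<close>

definition half_side :: "nat \<Rightarrow> real" where
  "half_side n = tan (pi / (2 * real n))"

lemma half_angle_bounds:
  assumes "n \<ge> 2"
  shows "0 < pi / (2 * real n)" "pi / (2 * real n) < pi / 2" "cos (pi / (2 * real n)) > 0"
proof -
  show *: "0 < pi / (2 * real n)" "pi / (2 * real n) < pi / 2" using assms by (auto simp: field_simps)
  show "cos (pi / (2 * real n)) > 0" using * by (intro cos_gt_zero_pi) auto
qed

lemma half_side_pos: "n \<ge> 2 \<Longrightarrow> half_side n > 0"
  unfolding half_side_def by (intro tan_gt_zero half_angle_bounds)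

lemma norm_out_normal [simp]: "norm (out_normal n j) = 1"
  by (simp add: out_normal_def)

lemma out_normal_inner_self: "out_normal n j \<bullet> out_normal n j = 1"
  by (simp add: dot_square_norm)

lemma inner_out_normal: "z \<bullet> out_normal n j = Re (z * cnj (out_normal n j))"
  by (simp add: inner_complex_def)

lemma out_normal_mult_cnj [simp]: "out_normal n j * cnj (out_normal n j) = 1"
  by (simp add: complex_norm_square[symmetric] del: of_real_power)

lemma recip_cos_mult_cis:
  assumes "cos x \<noteq> 0"
  shows "of_real (1 / cos x) * cis x = 1 + \<i> * of_real (tan x)"
  using assms by (simp add: complex_eq_iff tan_def)

lemma polyvert_Suc_eq:
  assumes "n \<ge> 2"
  shows "polyvert n (Suc j) = out_normal n j * (1 + \<i> * of_real (half_side n))"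
proof -
  let ?x = "pi / (2 * real n)"
  have "cis (pi * (2 * real (Suc j) - 1) / (2 * real n)) = out_normal n j * cis ?x"
    using assms by (simp add: out_normal_def cis_mult) (simp add: field_simps)
  then have "polyvert n (Suc j) = out_normal n j * (of_real (1 / cos ?x) * cis ?x)"
    by (simp add: polyvert_def)
  then show ?thesis
    using half_angle_bounds(3)[OF assms] by (subst (asm) recip_cos_mult_cis) (auto simp: half_side_def)
qed

lemma polyvert_eq:
  assumes "n \<ge> 2"
  shows "polyvert n j = out_normal n j * (1 - \<i> * of_real (half_side n))"
proof -
  let ?x = "pi / (2 * real n)"
  have "cis (pi * (2 * real j - 1) / (2 * real n)) = out_normal n j * cis (- ?x)"
    using assms by (simp add: out_normal_def cis_mult) (simp add: field_simps)
  then have "polyvert n j = out_normal n j * (of_real (1 / cos (- ?x)) * cis (- ?x))"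
    by (simp add: polyvert_def)
  then show ?thesis
    using half_angle_bounds(3)[OF assms] by (subst (asm) recip_cos_mult_cis) (auto simp: half_side_def)
qed

lemma polyvert_diff:
  assumes "n \<ge> 2"
  shows "polyvert n (Suc j) - polyvert n j = \<i> * out_normal n j * of_real (2 * half_side n)"
  unfolding polyvert_Suc_eq[OF assms] polyvert_eq[OF assms, of j] by (simp add: algebra_simps)

lemma side_param:
  assumes "n \<ge> 2"
  shows "polyvert n j + of_real t * (polyvert n (Suc j) - polyvert n j) =
    out_normal n j * (1 + \<i> * of_real ((2 * t - 1) * half_side n))"
  unfolding polyvert_diff[OF assms] unfolding polyvert_eq[OF assms, of j] by (simp add: algebra_simps)

lemma mem_side_iff:
  assumes "n \<ge> 2"
  shows "z \<in> side n j \<longleftrightarrow>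
    (\<exists>t\<in>{0..1}. z = out_normal n j * (1 + \<i> * of_real ((2 * t - 1) * half_side n)))"
  unfolding side_def side_param[OF assms, symmetric]
  by (auto simp: in_segment scaleR_conv_of_real algebra_simps)

lemma mem_open_side_iff:
  assumes "n \<ge> 2"
  shows "z \<in> open_side n j \<longleftrightarrow>
    (\<exists>t\<in>{0<..<1}. z = out_normal n j * (1 + \<i> * of_real ((2 * t - 1) * half_side n)))"
proof -
  have "polyvert n j \<noteq> polyvert n (Suc j)"
    using polyvert_diff[OF assms, of j] half_side_pos[OF assms] norm_out_normal[of n j]
    by (metis eq_iff_diff_eq_0 less_irrefl mult_eq_0_iff norm_zero of_real_eq_0_iff zero_neq_one complex_i_not_zero zero_neq_numeral)
  then show ?thesis
    unfolding open_side_def side_param[OF assms, symmetric]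
    by (auto simp: in_segment scaleR_conv_of_real algebra_simps)
qed

text \<open>With \<open>x = pi / (2 * n)\<close> the difference of the two cosines is
  \<open>2 * sin ((p + 1) * x) * sin (p * x)\<close>. As \<open>p\<close> is an integer, both angles
  lie in \<open>[0, pi]\<close> or both in \<open>[-pi, 0]\<close>, so the sines have no opposite
  signs.\<close>

lemma cos_odd_multiple_le:
  assumes "n > 0" "- 2 * int n \<le> p" "p < 2 * int n"
  shows "cos ((2 * of_int p + 1) * (pi / (2 * real n))) \<le> cos (pi / (2 * real n))"
proof -
  let ?x = "pi / (2 * real n)"
  have "cos ?x - cos ((2 * of_int p + 1) * ?x) =
    2 * sin (of_int (p + 1) * ?x) * sin (of_int p * ?x)"
  proof -
    let ?a = "of_int (p + 1) * ?x" and ?b = "of_int p * ?x"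
    have "?x = ?a - ?b" "(2 * of_int p + 1) * ?x = ?a + ?b"
      by (simp_all only: of_int_add of_int_1 distrib_right mult_1)
    then have "cos ?x = cos (?a - ?b)" "cos ((2 * of_int p + 1) * ?x) = cos (?a + ?b)"
      by (simp_all only:)
    then show ?thesis unfolding cos_diff cos_add by simp
  qed
  moreover have "sin (of_int (p + 1) * ?x) * sin (of_int p * ?x) \<ge> 0"
  proof (cases "p \<ge> 0")
    case True
    have "sin (of_int q * ?x) \<ge> 0" if "0 \<le> q" "q \<le> 2 * int n" for q
    proof (rule sin_ge_zero)
      have "of_int q \<le> 2 * real n" using that by linarith
      then have "of_int q * pi \<le> 2 * real n * pi" by (intro mult_right_mono) auto
      then show "of_int q * ?x \<le> pi" using assms(1) by (simp add: field_simps)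
    qed (use that in auto)
    from this[of p] this[of "p + 1"] show ?thesis
      using True assms by (intro mult_nonneg_nonneg) linarith+
  next
    case False
    have "sin (of_int q * ?x) \<le> 0" if "q \<le> 0" "- 2 * int n \<le> q" for q
    proof -
      have "sin (- (of_int q * ?x)) \<ge> 0"
      proof (rule sin_ge_zero)
        have "- of_int q \<le> 2 * real n" using that by linarith
        then have "- of_int q * pi \<le> 2 * real n * pi" by (intro mult_right_mono) auto
        then show "- (of_int q * ?x) \<le> pi" using assms(1) by (simp add: field_simps)
        have "of_int q * ?x \<le> 0" using that by (intro mult_nonpos_nonneg) auto
        then show "0 \<le> - (of_int q * ?x)" by simp
      qed
      then show ?thesis by simp
    qed
    from this[of p] this[of "p + 1"] show ?thesis
      using False assms by (intro mult_nonpos_nonpos) linarith+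
  qed
  ultimately show ?thesis by linarith
qed

lemma polyvert_inner_le:
  assumes "n \<ge> 2" "k \<in> {1..2*n}" "j \<in> {1..2*n}"
  shows "polyvert n k \<bullet> out_normal n j \<le> 1"
proof -
  let ?x = "pi / (2 * real n)"
  \<comment> \<open>Vertex \<open>k\<close> precedes the midpoint of side \<open>k\<close> by half a
    step, so its angle to normal \<open>j\<close> is the odd multiple \<open>2 * p + 1\<close> of
    \<open>pi / (2 * n)\<close>.\<close>
  define p where "p = int k - 1 - int j"
  have "polyvert n k * cnj (out_normal n j) =
    of_real (1 / cos ?x) * cis ((2 * of_int p + 1) * ?x)"
    using assms(1) unfolding polyvert_def out_normal_def cis_cnj mult.assoc cis_mult
    by (intro arg_cong2[where f = "(*)"] arg_cong[where f = cis] refl) (simp add: p_def field_simps)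
  then have "polyvert n k \<bullet> out_normal n j = cos ((2 * of_int p + 1) * ?x) / cos ?x"
    by (simp add: inner_out_normal)
  also have "\<dots> \<le> cos ?x / cos ?x"
    using assms half_angle_bounds(3)[OF assms(1)]
    by (intro divide_right_mono cos_odd_multiple_le) (auto simp: p_def)
  finally show ?thesis using half_angle_bounds(3)[OF assms(1)] by simp
qed

lemma convex_polygon: "convex (polygon n)"
  by (simp add: polygon_def convex_convex_hull)

lemma closed_polygon: "closed (polygon n)"
  unfolding polygon_def by (intro compact_imp_closed finite_imp_compact_convex_hull) simp

lemma polygon_halfplane:
  assumes "n \<ge> 2" "j \<in> {1..2*n}" "z \<in> polygon n"
  shows "z \<bullet> out_normal n j \<le> 1"
proof -
  have "polygon n \<subseteq> {z. out_normal n j \<bullet> z \<le> 1}"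
    unfolding polygon_def
  proof (rule hull_minimal)
    show "polyvert n ` {1..2 * n} \<subseteq> {z. out_normal n j \<bullet> z \<le> 1}"
      using polyvert_inner_le[OF assms(1) _ assms(2)] by (auto simp: inner_commute[of "out_normal n j"])
  qed (rule convex_halfspace_le)
  then show ?thesis using assms(3) by (auto simp: inner_commute)
qed

lemma polyvert_in_polygon:
  assumes "n \<ge> 2" "j \<in> {1..2*n}"
  shows "polyvert n j \<in> polygon n" "polyvert n (Suc j) \<in> polygon n"
proof -
  have *: "polyvert n k \<in> polygon n" if "k \<in> {1..2*n}" for k
    unfolding polygon_def using that by (intro hull_inc) simp
  show "polyvert n j \<in> polygon n" by (rule *[OF assms(2)])
  show "polyvert n (Suc j) \<in> polygon n"
  proof (cases "j = 2 * n")
    case True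
    have "cis (pi * (2 * real (Suc (2 * n)) - 1) / (2 * real n)) = cis (2 * pi + pi * (2 * real 1 - 1) / (2 * real n))"
      using assms(1) by (intro arg_cong[where f = cis]) (simp add: field_simps)
    also have "\<dots> = cis (pi * (2 * real 1 - 1) / (2 * real n))" by (simp add: cis_mult[symmetric])
    finally have "polyvert n (Suc j) = polyvert n 1" unfolding polyvert_def True by simp
    then show ?thesis using *[of 1] assms(1) by simp
  next
    case False
    then show ?thesis using *[of "Suc j"] assms(2) by simp
  qed
qed

text \<open>The side lies on its supporting line, and any outward step along the normal leaves the
  half-plane containing the polygon.\<close>

lemma side_subset_frontier:
  assumes "n \<ge> 2" "j \<in> {1..2*n}"
  shows "side n j \<subseteq> frontier (polygon n)"
proof
  fix z assume z: "z \<in> side n j"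
  have zP: "z \<in> polygon n"
    using closed_segment_subset[OF polyvert_in_polygon[OF assms] convex_polygon] z by (auto simp: side_def)
  have "(out_normal n j * (1 + \<i> * of_real s)) \<bullet> out_normal n j = 1" for s
  proof -
    have "out_normal n j * (1 + \<i> * of_real s) * cnj (out_normal n j) = 1 + \<i> * of_real s"
      using out_normal_mult_cnj[of n j] by (metis mult.assoc mult.commute mult_1)
    then show ?thesis unfolding inner_out_normal by (simp only:) simp
  qed
  then have z1: "z \<bullet> out_normal n j = 1" using z unfolding mem_side_iff[OF assms(1)] by blast
  have "z \<notin> interior (polygon n)"
  proof
    assume "z \<in> interior (polygon n)"
    then obtain e where e: "e > 0" "cball z e \<subseteq> polygon n" using mem_interior_cball by blast
    have "z + e *\<^sub>R out_normal n j \<in> cball z e" using e(1) by (simp add: dist_norm)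
    then have "(z + e *\<^sub>R out_normal n j) \<bullet> out_normal n j \<le> 1"
      using e(2) polygon_halfplane[OF assms] by blast
    then show False using e(1) z1 by (simp add: inner_add_left out_normal_inner_self)
  qed
  then show "z \<in> frontier (polygon n)" using zP closure_subset by (auto simp: frontier_def)
qed

section \<open>The conformal map\<close>

text \<open>The exponent \<open>1 / n\<close> is the exterior angle \<open>pi / n\<close> divided by
  \<open>pi\<close>. Dividing by the value at 1 sends arc centres to side midpoints.\<close>

definition sc_map :: "nat \<Rightarrow> complex \<Rightarrow> complex" where
  "sc_map n z = sc_prim (1 / real n) n 1 z / sc_prim (1 / real n) n 1 1"

definition sc_map_deriv :: "nat \<Rightarrow> complex \<Rightarrow> complex" where
  "sc_map_deriv n z = sc_deriv (1 / real n) n 1 z / sc_prim (1 / real n) n 1 1"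

lemma sc_map_normalizer:
  assumes "n \<ge> 2"
  obtains c where "c > 0" "sc_prim (1 / real n) n 1 1 = of_real c"
  by (rule sc_prim_1_pos[of "1 / real n" n 1]) (use assms that in auto)

lemma continuous_on_sc_map:
  assumes "n \<ge> 2"
  shows "continuous_on (cball 0 1) (sc_map n)"
proof -
  obtain c where "c > 0" "sc_prim (1 / real n) n 1 1 = of_real c"
    using sc_map_normalizer[OF assms] .
  then show ?thesis unfolding sc_map_def[abs_def]
    by (intro continuous_on_divide continuous_on_sc_prim) (use assms in auto)
qed

lemma has_field_derivative_sc_map:
  assumes "n \<ge> 2" "z \<in> cball 0 1" "z ^ (2 * n) \<noteq> -1"
  shows "(sc_map n has_field_derivative sc_map_deriv n z) (at z within cball 0 1)"
  unfolding sc_map_def[abs_def] sc_map_deriv_def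
  by (intro DERIV_cdivide has_field_derivative_sc_prim) (use assms in auto)

lemma power_2n_neq_interior:
  fixes z :: complex
  assumes "n > 0" "norm z < 1"
  shows "z ^ (2 * n) \<noteq> -1"
proof
  assume "z ^ (2 * n) = -1"
  then have "norm z ^ (2 * n) = 1" by (metis norm_minus_cancel norm_one norm_power)
  moreover have "norm z ^ (2 * n) < 1" using assms by (simp add: power_less_one_iff)
  ultimately show False by simp
qed

lemma sc_map_deriv_nonzero:
  assumes "n \<ge> 2" "z \<in> cball 0 1" "z ^ (2 * n) \<noteq> -1"
  shows "sc_map_deriv n z \<noteq> 0"
proof -
  have "norm (z ^ (2 * n)) \<le> 1" using assms(2) by (simp add: norm_power power_le_one)
  from one_plus_notin_nonpos_Reals[OF this assms(3)] have "1 + z ^ (2 * n) \<noteq> 0" by auto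
  moreover obtain c where "c > 0" "sc_prim (1 / real n) n 1 1 = of_real c"
    using sc_map_normalizer[OF assms(1)] .
  ultimately show ?thesis by (simp add: sc_map_deriv_def sc_deriv_def)
qed

text \<open>Since \<open>\<bar>arg (1 + z ^ (2 * n))\<bar> < pi / 2\<close> on the disc, the derivative has argument less
  than \<open>pi / (2 * n)\<close> in absolute value.\<close>

lemma Re_sc_map_deriv_pos:
  assumes "n \<ge> 2" "norm z < 1"
  shows "Re (sc_map_deriv n z) > 0"
proof -
  define w where "w = 1 + z ^ (2 * n)"
  have "norm (z ^ (2 * n)) < 1" using assms by (simp add: norm_power power_less_one_iff)
  then have "Re w > 0" using abs_Re_le_cmod[of "z ^ (2 * n)"] by (simp add: w_def)
  then have w: "w \<noteq> 0" by auto
  then have "\<bar>Im (Ln w)\<bar> < pi / 2" using Re_Ln_pos_lt[of w] \<open>Re w > 0\<close> by simp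
  note w = w this
  have "\<bar>1 / real n * Im (Ln w)\<bar> \<le> 1 * \<bar>Im (Ln w)\<bar>"
    unfolding abs_mult using assms(1) by (intro mult_right_mono) auto
  then have lt: "\<bar>1 / real n * Im (Ln w)\<bar> < pi / 2" using w(2) by linarith
  have "w powr (- of_real (1 / real n)) = exp (- of_real (1 / real n) * Ln w)"
    using w(1) by (simp add: powr_def)
  then have "Re (w powr (- of_real (1 / real n))) =
      exp (- (1 / real n) * Re (Ln w)) * cos (1 / real n * Im (Ln w))"
    by (simp add: Re_exp)
  then have "Re (w powr (- of_real (1 / real n))) > 0"
    using cos_gt_zero_abs[OF lt] by simp
  moreover obtain c where "c > 0" "sc_prim (1 / real n) n 1 1 = of_real c"
    using sc_map_normalizer[OF assms(1)] .
  ultimately show ?thesis by (simp add: sc_map_deriv_def sc_deriv_def w_def)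
qed

lemma inj_on_sc_map:
  assumes "n \<ge> 2"
  shows "inj_on (sc_map n) (cball 0 1)"
proof (rule inj_on_cball_Re_deriv_pos[where f' = "sc_map_deriv n"])
  fix z :: complex assume z: "z \<in> ball 0 1"
  have "(sc_map n has_field_derivative sc_map_deriv n z) (at z within ball 0 1)"
    using has_field_derivative_sc_map[OF assms, of z] power_2n_neq_interior[of n z] z assms
    by (auto intro: has_field_derivative_subset)
  then show "(sc_map n has_field_derivative sc_map_deriv n z) (at z)"
    using z by (simp add: at_within_open[of z "ball 0 1"])
qed (use assms Re_sc_map_deriv_pos continuous_on_sc_map in auto)

text \<open>For a conformal map \<open>f\<close>, \<open>z * f' z\<close> is normal to the image of
  the circle. Its direction here does not depend on \<open>\<phi>\<close>, which is why each arc has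
  a straight image.\<close>

lemma sc_map_deriv_arc_pt:
  assumes "n \<ge> 2" "\<bar>\<phi>\<bar> < pi / 2"
  obtains r where "r > 0"
    "arc_pt n j \<phi> * sc_map_deriv n (arc_pt n j \<phi>) = of_real r * out_normal n j"
proof -
  obtain c where c: "c > 0" "sc_prim (1 / real n) n 1 1 = of_real c"
    using sc_map_normalizer[OF assms(1)] .
  have "real 1 * (pi * real j + \<phi>) / real n - 1 / real n * \<phi> = pi * real j / real n"
    using assms(1) by (simp add: field_simps)
  then have "arc_pt n j \<phi> * sc_deriv (1 / real n) n 1 (arc_pt n j \<phi>) =
      of_real ((2 * cos \<phi>) powr (- (1 / real n))) * out_normal n j"
    using sc_deriv_arc_pt[of n 1 \<phi> j "1 / real n"] assms by (simp add: out_normal_def)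
  then have "arc_pt n j \<phi> * sc_map_deriv n (arc_pt n j \<phi>) =
      of_real ((2 * cos \<phi>) powr (- (1 / real n)) / c) * out_normal n j"
    unfolding sc_map_deriv_def c(2) times_divide_eq_right by simp
  moreover have "(2 * cos \<phi>) powr (- (1 / real n)) / c > 0"
    using cos_gt_zero_abs[OF assms(2)] c(1) by simp
  ultimately show ?thesis using that by blast
qed

section \<open>Boundary correspondence between arcs and sides\<close>

text \<open>On arc \<open>j\<close> this is the signed coordinate along the line of side
  \<open>j\<close>, measured from its midpoint.\<close>

definition arc_height :: "nat \<Rightarrow> nat \<Rightarrow> real \<Rightarrow> real" where
  "arc_height n j \<phi> = Im (sc_map n (arc_pt n j \<phi>) * cnj (out_normal n j))"

text \<open>The derivative is required only inside the arc; its ends are prevertices and are reached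
  by continuity.\<close>

lemma eq_center_of_DERIV_zero:
  fixes f :: "real \<Rightarrow> real"
  assumes f: "continuous_on {- (pi / 2)..pi / 2} f"
    and d: "\<And>x. \<bar>x\<bar> < pi / 2 \<Longrightarrow> (f has_vector_derivative 0) (at x)" and x: "\<bar>x\<bar> \<le> pi / 2"
  shows "f x = f 0"
proof -
  have "f y = f (- (pi / 2))" if "\<bar>y\<bar> \<le> pi / 2" for y
    by (rule DERIV_isconst2[OF _ f])
       (use that d in \<open>auto simp: has_real_derivative_iff_has_vector_derivative\<close>)
  from this[of x] this[of 0] x show ?thesis by simp
qed

lemma continuous_on_along_arc:
  assumes "continuous_on (cball 0 1) F"
  shows "continuous_on S (\<lambda>\<phi>. F (arc_pt n j \<phi>))"
  by (rule continuous_on_compose2[OF assms]) (auto intro: continuous_intros)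

text \<open>After rotation by \<open>cnj (out_normal n j)\<close> the image curve has a positive
  multiple of \<open>\<i>\<close> as derivative: its real part keeps the central value 1 and its
  imaginary part increases.\<close>

lemma
  assumes n: "n \<ge> 2"
  shows sc_map_arc_pt: "\<And>\<phi>. \<bar>\<phi>\<bar> \<le> pi / 2 \<Longrightarrow>
      sc_map n (arc_pt n j \<phi>) = out_normal n j * (1 + \<i> * of_real (arc_height n j \<phi>))"
    and continuous_on_arc_height: "continuous_on S (arc_height n j)"
    and arc_height_less: "\<And>\<phi> \<psi>. - (pi / 2) \<le> \<phi> \<Longrightarrow> \<phi> < \<psi> \<Longrightarrow> \<psi> \<le> pi / 2 \<Longrightarrow>
      arc_height n j \<phi> < arc_height n j \<psi>"
proof -
  define f where "f = (\<lambda>\<phi>. sc_map n (arc_pt n j \<phi>) * cnj (out_normal n j))"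
  have cont: "continuous_on S f" for S
    unfolding f_def by (intro continuous_intros continuous_on_along_arc continuous_on_sc_map n)
  have der: "\<exists>r>0. (f has_vector_derivative \<i> * of_real r) (at \<phi>)" if \<phi>: "\<bar>\<phi>\<bar> < pi / 2" for \<phi>
  proof -
    obtain r where r: "r > 0" "arc_pt n j \<phi> * sc_map_deriv n (arc_pt n j \<phi>) = of_real r * out_normal n j"
      using sc_map_deriv_arc_pt[OF n \<phi>] by blast
    have "(sc_map n has_field_derivative sc_map_deriv n (arc_pt n j \<phi>)) (at (arc_pt n j \<phi>) within cball 0 1)"
      using n \<phi> arc_pt_power_2n_neq[of n \<phi> j] by (intro has_field_derivative_sc_map) auto
    from has_vector_derivative_mult_left[OF has_vector_derivative_along_arc[OF this], of "cnj (out_normal n j)"]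
    have "(f has_vector_derivative \<i> / of_nat n * (of_real r * out_normal n j) * cnj (out_normal n j)) (at \<phi>)"
      unfolding f_def r(2) .
    moreover have "\<i> / of_nat n * (of_real r * out_normal n j) * cnj (out_normal n j) =
        \<i> * of_real (r / real n) * (out_normal n j * cnj (out_normal n j))"
      by (simp add: mult_ac del: out_normal_mult_cnj)
    ultimately have "(f has_vector_derivative \<i> * of_real (r / real n)) (at \<phi>)"
      by (simp only: out_normal_mult_cnj mult_1_right)
    then show ?thesis using r(1) n by (intro exI[of _ "r / real n"]) auto
  qed
  have f0: "f 0 = 1"
  proof -
    obtain c where c: "c > 0" "sc_prim (1 / real n) n 1 1 = of_real c"
      using sc_map_normalizer[OF n] .
    have "sc_map n (arc_pt n j 0) = out_normal n j"
      using n c by (simp add: sc_map_def sc_prim_arc_center out_normal_def)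
    then show ?thesis by (simp add: f_def)
  qed
  have Re: "Re (f \<phi>) = 1" if "\<bar>\<phi>\<bar> \<le> pi / 2" for \<phi>
  proof -
    have "Re (f \<phi>) = Re (f 0)"
    proof (rule eq_center_of_DERIV_zero[OF _ _ that, of "\<lambda>\<phi>. Re (f \<phi>)"])
      fix x :: real assume "\<bar>x\<bar> < pi / 2"
      then obtain r where "(f has_vector_derivative \<i> * of_real r) (at x)" using der by blast
      from bounded_linear.has_vector_derivative[OF bounded_linear_Re this]
      show "((\<lambda>\<phi>. Re (f \<phi>)) has_vector_derivative 0) (at x)" by simp
    qed (intro continuous_intros cont)
    then show ?thesis by (simp add: f0)
  qed
  have h: "arc_height n j = (\<lambda>\<phi>. Im (f \<phi>))" by (simp add: arc_height_def[abs_def] f_def)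
  show "continuous_on S (arc_height n j)" unfolding h by (intro continuous_intros cont)
  show "sc_map n (arc_pt n j \<phi>) = out_normal n j * (1 + \<i> * of_real (arc_height n j \<phi>))"
    if "\<bar>\<phi>\<bar> \<le> pi / 2" for \<phi>
  proof -
    have "1 + \<i> * of_real (arc_height n j \<phi>) = f \<phi>"
      using Re[OF that] by (simp add: h complex_eq_iff)
    then have "out_normal n j * (1 + \<i> * of_real (arc_height n j \<phi>)) =
        sc_map n (arc_pt n j \<phi>) * (out_normal n j * cnj (out_normal n j))"
      unfolding f_def by (simp only: mult_ac)
    then show ?thesis by simp
  qed
  show "arc_height n j \<phi> < arc_height n j \<psi>"
    if "- (pi / 2) \<le> \<phi>" "\<phi> < \<psi>" "\<psi> \<le> pi / 2" for \<phi> \<psi>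
    unfolding h
  proof (rule DERIV_pos_imp_increasing_open[OF that(2), of "\<lambda>\<phi>. Im (f \<phi>)"])
    fix x assume "\<phi> < x" "x < \<psi>"
    then have "\<bar>x\<bar> < pi / 2" using that by linarith
    then obtain r where r: "r > 0" "(f has_vector_derivative \<i> * of_real r) (at x)" using der by blast
    from bounded_linear.has_vector_derivative[OF bounded_linear_Im this(2)]
    have "DERIV (\<lambda>\<phi>. Im (f \<phi>)) x :> r" by (simp add: has_real_derivative_iff_has_vector_derivative)
    then show "\<exists>y. DERIV (\<lambda>\<phi>. Im (f \<phi>)) x :> y \<and> y > 0" using r(1) by blast
  qed (intro continuous_intros cont)
qed

lemma arc_pt_shared_endpoint: "arc_pt n (Suc j) (- (pi / 2)) = arc_pt n j (pi / 2)"
  unfolding arc_pt_def by (rule arg_cong[where f = cis]) (simp add: algebra_simps)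

text \<open>The image of a prevertex lies on the supporting lines of both adjacent sides.\<close>

lemma arc_height_shared_endpoint:
  assumes n: "n \<ge> 2"
  shows "arc_height n j (pi / 2) = half_side n" "arc_height n (Suc j) (- (pi / 2)) = - half_side n"
proof -
  define y where "y = pi / real n"
  let ?h = "arc_height n j (pi / 2)" and ?k = "arc_height n (Suc j) (- (pi / 2))"
  have "0 < y" "y < pi" using n by (auto simp: y_def field_simps)
  then have s: "sin y > 0" by (rule sin_gt_zero)
  have "cos y \<noteq> -1"
  proof
    assume "cos y = -1"
    then show False using s sin_cos_squared_add[of y] by simp
  qed
  then have c: "cos y + 1 \<noteq> 0" by linarith
  have t: "half_side n = sin y / (cos y + 1)"
    using tan_half[of "pi / (2 * real n)"] by (simp add: half_side_def y_def)
  have "out_normal n (Suc j) = out_normal n j * cis y"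
    by (simp add: out_normal_def cis_mult y_def add_divide_distrib[symmetric] algebra_simps)
  then have "out_normal n j * (1 + \<i> * of_real ?h) = out_normal n j * (cis y * (1 + \<i> * of_real ?k))"
    using sc_map_arc_pt[OF n, of "pi / 2" j] sc_map_arc_pt[OF n, of "- (pi / 2)" "Suc j"]
    by (simp add: arc_pt_shared_endpoint mult.assoc)
  moreover have "out_normal n j \<noteq> 0" using norm_out_normal[of n j] by (metis norm_zero zero_neq_one)
  ultimately have "1 + \<i> * of_real ?h = cis y * (1 + \<i> * of_real ?k)" by simp
  \<comment> \<open>Intersection of the two supporting lines: the real part determines
    \<open>?k\<close> as \<open>- tan (y / 2)\<close>, and the imaginary part then gives
    \<open>?h\<close>.\<close>
  then have eqs: "1 = cos y - sin y * ?k" "?h = sin y + cos y * ?k"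
    by (auto simp: complex_eq_iff)
  have sq: "sin y * sin y = (1 - cos y) * (1 + cos y)"
    using sin_cos_squared_add[of y] by (simp add: power2_eq_square algebra_simps)
  have "sin y * (?k * (cos y + 1)) = sin y * (- sin y)"
  proof -
    have "sin y * (?k * (cos y + 1)) = (sin y * ?k) * (cos y + 1)" by simp
    also have "sin y * ?k = cos y - 1" using eqs(1) by linarith
    also have "(cos y - 1) * (cos y + 1) = sin y * (- sin y)"
      using sq by (simp add: algebra_simps)
    finally show ?thesis .
  qed
  then have "?k * (cos y + 1) = - sin y" using s by (simp only: mult_cancel_left) auto
  then have k: "?k = - (sin y / (cos y + 1))" using c by (simp add: field_simps)
  then show "?k = - half_side n" by (simp add: t)
  show "?h = half_side n" unfolding eqs(2) k t using c by (simp add: field_simps)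
qed

lemma abs_arc_height_le:
  assumes "n \<ge> 2" "j \<ge> 1" "\<bar>\<phi>\<bar> \<le> pi / 2"
  shows "\<bar>arc_height n j \<phi>\<bar> \<le> half_side n"
proof -
  obtain i where j: "j = Suc i" using assms(2) by (cases j) auto
  have mono: "arc_height n j x \<le> arc_height n j y" if "- (pi / 2) \<le> x" "x \<le> y" "y \<le> pi / 2" for x y
    using arc_height_less[OF assms(1), of x y j] that by (cases "x = y") auto
  have "arc_height n j \<phi> \<le> arc_height n j (pi / 2)"
    by (rule mono) (use assms(3) in auto)
  moreover have "arc_height n j (- (pi / 2)) \<le> arc_height n j \<phi>"
    by (rule mono) (use assms(3) in auto)
  ultimately show ?thesis
    using arc_height_shared_endpoint(1)[OF assms(1), of j] arc_height_shared_endpoint(2)[OF assms(1), of i]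
    by (simp add: j)
qed

lemma sc_map_arc_pt_in_side:
  assumes "n \<ge> 2" "j \<ge> 1" "\<bar>\<phi>\<bar> \<le> pi / 2"
  shows "sc_map n (arc_pt n j \<phi>) \<in> side n j"
proof -
  define t where "t = (arc_height n j \<phi> / half_side n + 1) / 2"
  have "t \<in> {0..1}" "(2 * t - 1) * half_side n = arc_height n j \<phi>"
    using abs_arc_height_le[OF assms] half_side_pos[OF assms(1)] by (auto simp: t_def field_simps)
  then show ?thesis
    unfolding mem_side_iff[OF assms(1)] sc_map_arc_pt[OF assms(1,3)] by metis
qed

text \<open>The height runs continuously from \<open>- half_side n\<close> to
  \<open>half_side n\<close>. A point strictly inside the side has a height different from both, so
  its preimage is not an arc end.\<close>

lemma side_point_preimage:
  assumes n: "n \<ge> 2" and j: "j \<ge> 1" and t: "0 \<le> t" "t \<le> 1"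
  obtains \<phi> where "\<bar>\<phi>\<bar> \<le> pi / 2" "0 < t \<Longrightarrow> t < 1 \<Longrightarrow> \<bar>\<phi>\<bar> < pi / 2"
    "sc_map n (arc_pt n j \<phi>) = out_normal n j * (1 + \<i> * of_real ((2 * t - 1) * half_side n))"
proof -
  obtain i where ji: "j = Suc i" using j by (cases j) auto
  have e: "arc_height n j (pi / 2) = half_side n" "arc_height n j (- (pi / 2)) = - half_side n"
    using arc_height_shared_endpoint[OF n] ji by auto
  have b: "0 \<le> t * half_side n" "t * half_side n \<le> 1 * half_side n"
    using t half_side_pos[OF n] by (auto intro: mult_right_mono)
  have "\<exists>\<phi>\<ge>- (pi / 2). \<phi> \<le> pi / 2 \<and> arc_height n j \<phi> = (2 * t - 1) * half_side n"
    by (rule IVT') (use e b in \<open>auto simp: algebra_simps intro: continuous_on_arc_height n\<close>)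
  then obtain \<phi> where \<phi>: "- (pi / 2) \<le> \<phi>" "\<phi> \<le> pi / 2" "arc_height n j \<phi> = (2 * t - 1) * half_side n"
    by blast
  have "\<bar>\<phi>\<bar> < pi / 2" if "0 < t" "t < 1"
  proof -
    have "0 < t * half_side n" "t * half_side n < 1 * half_side n"
      using that half_side_pos[OF n] by (auto intro: mult_strict_right_mono)
    then have "(2 * t - 1) * half_side n \<noteq> half_side n" "(2 * t - 1) * half_side n \<noteq> - half_side n"
      by (auto simp: algebra_simps)
    then have "\<phi> \<noteq> pi / 2" "\<phi> \<noteq> - (pi / 2)" using \<phi>(3) e by metis+
    then show ?thesis using \<phi> by auto
  qed
  with \<phi> show ?thesis using sc_map_arc_pt[OF n, of \<phi> j] by (intro that[of \<phi>]) auto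
qed

lemma sc_map_image:
  assumes n: "n \<ge> 2"
  shows "sc_map n ` ball 0 1 = interior (polygon n)" "sc_map n ` cball 0 1 = polygon n"
proof -
  have "sc_map n ` sphere 0 1 \<subseteq> frontier (polygon n)"
  proof
    fix z assume "z \<in> sc_map n ` sphere 0 1"
    then obtain w where w: "w \<in> sphere 0 1" "z = sc_map n w" by blast
    have "n > 0" using n by simp
    from sphere_arc_pt[OF this w(1)] obtain j \<phi> where
      "j \<in> {1..2*n}" "\<bar>\<phi>\<bar> \<le> pi / 2" "w = arc_pt n j \<phi>" by blast
    then show "z \<in> frontier (polygon n)"
      using sc_map_arc_pt_in_side[OF n, of j \<phi>] side_subset_frontier[OF n, of j] w(2) by auto
  qed
  note * = image_cball_eq_convex[OF zero_less_one continuous_on_sc_map[OF n] inj_on_sc_map[OF n]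
    convex_polygon closed_polygon this]
  show "sc_map n ` ball 0 1 = interior (polygon n)" by (rule *(1))
  show "sc_map n ` cball 0 1 = polygon n" by (rule *(2))
qed

section \<open>Potentials on the disc and on the polygon\<close>

definition sc_inv :: "nat \<Rightarrow> complex \<Rightarrow> complex" where
  "sc_inv n = inv_into (cball 0 1) (sc_map n)"

lemma sc_inv_sc_map: "n \<ge> 2 \<Longrightarrow> z \<in> cball 0 1 \<Longrightarrow> sc_inv n (sc_map n z) = z"
  unfolding sc_inv_def by (rule inv_into_f_f[OF inj_on_sc_map])

lemma continuous_on_sc_inv:
  assumes "n \<ge> 2"
  shows "continuous_on (polygon n) (sc_inv n)"
  unfolding sc_map_image(2)[OF assms, symmetric]
  by (rule continuous_on_inv[OF continuous_on_sc_map[OF assms] compact_cball])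
     (use sc_inv_sc_map[OF assms] in blast)

lemma sc_inv_in_cball: "n \<ge> 2 \<Longrightarrow> z \<in> polygon n \<Longrightarrow> sc_inv n z \<in> cball 0 1"
  using sc_map_image(2) sc_inv_sc_map by force

text \<open>The inverse is continuous up to the boundary by compactness, and the derivative of the
  map is nonzero off the prevertices; the inverse rule therefore applies within the closed
  polygon.\<close>

lemma has_field_derivative_sc_inv:
  assumes n: "n \<ge> 2" and z: "z \<in> cball 0 1" "z ^ (2 * n) \<noteq> -1"
  shows "(sc_inv n has_field_derivative 1 / sc_map_deriv n z) (at (sc_map n z) within polygon n)"
  unfolding has_field_derivative_def sc_map_image(2)[OF n, symmetric]
proof (rule has_derivative_inverse_within)
  show "(sc_map n has_derivative (*) (sc_map_deriv n z)) (at z within cball 0 1)"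
    using has_field_derivative_sc_map[OF assms] by (simp add: has_field_derivative_def)
  show "continuous (at (sc_map n z) within sc_map n ` cball 0 1) (sc_inv n)"
    using continuous_on_sc_inv[OF n] z(1) unfolding sc_map_image(2)[OF n, symmetric]
    by (auto simp: continuous_on_eq_continuous_within)
  show "linear ((*) (1 / sc_map_deriv n z))"
    by (rule bounded_linear.linear[OF bounded_linear_mult_right])
  show "(*) (1 / sc_map_deriv n z) \<circ> (*) (sc_map_deriv n z) = id"
    using sc_map_deriv_nonzero[OF assms] by (auto simp: fun_eq_iff)
qed (use z sc_inv_sc_map[OF n] in auto)

text \<open>The conjugate exponents make the real part of the potential constant on the even arcs and the
  imaginary part constant on the odd arcs.\<close>

definition disc_potential :: "complex \<Rightarrow> nat \<Rightarrow> nat \<Rightarrow> complex \<Rightarrow> complex" where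
  "disc_potential \<gamma> n k z = \<gamma> * sc_prim (1 / 2) n k z + cnj \<gamma> * sc_prim (1 / 2) n (n - k) z"

definition disc_potential_deriv :: "complex \<Rightarrow> nat \<Rightarrow> nat \<Rightarrow> complex \<Rightarrow> complex" where
  "disc_potential_deriv \<gamma> n k z = \<gamma> * sc_deriv (1 / 2) n k z + cnj \<gamma> * sc_deriv (1 / 2) n (n - k) z"

lemma continuous_on_disc_potential:
  assumes "0 < k" "k < n"
  shows "continuous_on (cball 0 1) (disc_potential \<gamma> n k)"
  unfolding disc_potential_def[abs_def]
  by (intro continuous_intros continuous_on_sc_prim) (use assms in auto)

lemma has_field_derivative_disc_potential:
  assumes "0 < k" "k < n" "z \<in> cball 0 1" "z ^ (2 * n) \<noteq> -1"
  shows "(disc_potential \<gamma> n k has_field_derivative disc_potential_deriv \<gamma> n k z) (at z within cball 0 1)"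
  unfolding disc_potential_def[abs_def] disc_potential_deriv_def
  by (intro DERIV_add DERIV_cmult has_field_derivative_sc_prim) (use assms in auto)

lemma cis_pi_times: "cis (pi * real j) = (-1) ^ j"
  by (simp add: complex_eq_iff mult.commute[of pi])

text \<open>The arguments belonging to \<open>k\<close> and \<open>n - k\<close> add up to
  \<open>pi * j\<close>, so the second term is \<open>(-1) ^ j\<close> times the conjugate of the
  first: the sum is real on even arcs and purely imaginary on odd ones.\<close>

lemma disc_potential_deriv_arc_pt:
  fixes j k n :: nat and \<gamma> :: complex and \<phi> :: real
  assumes k: "0 < k" "k < n" and \<phi>: "\<bar>\<phi>\<bar> < pi / 2"
  defines "w \<equiv> \<gamma> * cis (real k * (pi * real j + \<phi>) / real n - \<phi> / 2)"
  shows "arc_pt n j \<phi> * disc_potential_deriv \<gamma> n k (arc_pt n j \<phi>) =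
    of_real ((2 * cos \<phi>) powr (- (1 / 2))) * (w + (-1) ^ j * cnj w)"
proof -
  have n: "n > 0" using k by simp
  let ?b = "real k * (pi * real j + \<phi>) / real n - \<phi> / 2"
  have "real (n - k) * (pi * real j + \<phi>) / real n - 1 / 2 * \<phi> = pi * real j + (- ?b)"
    using k by (simp add: of_nat_diff field_simps)
  then have "cis (real (n - k) * (pi * real j + \<phi>) / real n - 1 / 2 * \<phi>) = (-1) ^ j * cnj (cis ?b)"
    by (simp only: cis_mult[symmetric] cis_pi_times cis_cnj)
  then show ?thesis
    using sc_deriv_arc_pt[OF n k(1) \<phi>, of j "1 / 2"] sc_deriv_arc_pt[OF n _ \<phi>, of "n - k" j "1 / 2"] k
    by (simp add: disc_potential_deriv_def w_def algebra_simps)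
qed

lemma Im_disc_potential_deriv_even:
  assumes "0 < k" "k < n" "\<bar>\<phi>\<bar> < pi / 2" "even j"
  shows "Im (arc_pt n j \<phi> * disc_potential_deriv \<gamma> n k (arc_pt n j \<phi>)) = 0"
  unfolding disc_potential_deriv_arc_pt[OF assms(1-3)] using assms(4) by (simp add: complex_add_cnj)

lemma Re_disc_potential_deriv_odd:
  assumes "0 < k" "k < n" "\<bar>\<phi>\<bar> < pi / 2" "odd j"
  shows "Re (arc_pt n j \<phi> * disc_potential_deriv \<gamma> n k (arc_pt n j \<phi>)) = 0"
  unfolding disc_potential_deriv_arc_pt[OF assms(1-3)] using assms(4) by simp

lemma disc_potential_along_arc:
  assumes "0 < k" "k < n" "\<bar>\<phi>\<bar> < pi / 2"
  shows "((\<lambda>\<phi>. disc_potential \<gamma> n k (arc_pt n j \<phi>)) has_vector_derivative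
    \<i> / of_nat n * (arc_pt n j \<phi> * disc_potential_deriv \<gamma> n k (arc_pt n j \<phi>))) (at \<phi>)"
  using assms arc_pt_power_2n_neq[of n \<phi> j]
  by (intro has_vector_derivative_along_arc has_field_derivative_disc_potential) auto

definition potential_const :: "nat \<Rightarrow> nat \<Rightarrow> real" where
  "potential_const n k = Re (sc_prim (1 / 2) n k 1) + Re (sc_prim (1 / 2) n (n - k) 1)"

text \<open>The values of the two primitives at 1 enter with equal sign in the real part for even
  \<open>j\<close> and in the imaginary part for odd \<open>j\<close>. Node values and conjugate
  values thus share one constant, and no special value survives in the eigenvalues.\<close>

lemma
  assumes k: "0 < k" "k < n"
  shows potential_const_pos: "potential_const n k > 0"
    and Re_disc_potential_center: "even j \<Longrightarrow>
      Re (disc_potential \<gamma> n k (arc_pt n j 0)) = potential_const n k * Re (\<gamma> * cis (pi * real j * real k / real n))"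
    and Im_disc_potential_center: "odd j \<Longrightarrow>
      Im (disc_potential \<gamma> n k (arc_pt n j 0)) = potential_const n k * Im (\<gamma> * cis (pi * real j * real k / real n))"
proof -
  have n: "n > 0" using k by simp
  obtain c where c: "c > 0" "sc_prim (1 / 2) n k 1 = of_real c"
    by (rule sc_prim_1_pos[of "1 / 2" n k]) (use k in auto)
  obtain d where d: "d > 0" "sc_prim (1 / 2) n (n - k) 1 = of_real d"
    by (rule sc_prim_1_pos[of "1 / 2" n "n - k"]) (use k in auto)
  show "potential_const n k > 0" using c d by (simp add: potential_const_def)
  define w where "w = \<gamma> * cis (pi * real j * real k / real n)"
  have "pi * real j * real (n - k) / real n = pi * real j + (- (pi * real j * real k / real n))"
    using k by (simp add: of_nat_diff field_simps)
  then have "cis (pi * real j * real (n - k) / real n) = (-1) ^ j * cnj (cis (pi * real j * real k / real n))"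
    by (simp only: cis_mult[symmetric] cis_pi_times cis_cnj)
  then have eq: "disc_potential \<gamma> n k (arc_pt n j 0) = w * of_real c + (-1) ^ j * cnj w * of_real d"
    unfolding disc_potential_def sc_prim_arc_center[OF n] c(2) d(2) w_def by simp
  show "Re (disc_potential \<gamma> n k (arc_pt n j 0)) = potential_const n k * Re w" if "even j"
    using that unfolding eq potential_const_def c(2) d(2) by (simp add: algebra_simps)
  show "Im (disc_potential \<gamma> n k (arc_pt n j 0)) = potential_const n k * Im w" if "odd j"
    using that unfolding eq potential_const_def c(2) d(2) by (simp add: algebra_simps)
qed

lemma Re_disc_potential_even:
  assumes "0 < k" "k < n" "\<bar>\<phi>\<bar> \<le> pi / 2" "even j"
  shows "Re (disc_potential \<gamma> n k (arc_pt n j \<phi>)) =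
    potential_const n k * Re (\<gamma> * cis (pi * real j * real k / real n))"
proof -
  have "Re (disc_potential \<gamma> n k (arc_pt n j \<phi>)) = Re (disc_potential \<gamma> n k (arc_pt n j 0))"
  proof (rule eq_center_of_DERIV_zero[OF _ _ assms(3), of "\<lambda>\<phi>. Re (disc_potential \<gamma> n k (arc_pt n j \<phi>))"])
    fix x :: real assume x: "\<bar>x\<bar> < pi / 2"
    from bounded_linear.has_vector_derivative[OF bounded_linear_Re disc_potential_along_arc[OF assms(1,2) x, of \<gamma> j]]
    show "((\<lambda>\<phi>. Re (disc_potential \<gamma> n k (arc_pt n j \<phi>))) has_vector_derivative 0) (at x)"
      using Im_disc_potential_deriv_even[OF assms(1,2) x assms(4), of \<gamma>] by (simp add: Re_divide_of_nat del: times_complex.sel)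
  qed (intro continuous_intros continuous_on_along_arc continuous_on_disc_potential assms)
  then show ?thesis using Re_disc_potential_center assms by simp
qed

lemma Im_disc_potential_odd:
  assumes "0 < k" "k < n" "\<bar>\<phi>\<bar> \<le> pi / 2" "odd j"
  shows "Im (disc_potential \<gamma> n k (arc_pt n j \<phi>)) =
    potential_const n k * Im (\<gamma> * cis (pi * real j * real k / real n))"
proof -
  have "Im (disc_potential \<gamma> n k (arc_pt n j \<phi>)) = Im (disc_potential \<gamma> n k (arc_pt n j 0))"
  proof (rule eq_center_of_DERIV_zero[OF _ _ assms(3), of "\<lambda>\<phi>. Im (disc_potential \<gamma> n k (arc_pt n j \<phi>))"])
    fix x :: real assume x: "\<bar>x\<bar> < pi / 2"
    from bounded_linear.has_vector_derivative[OF bounded_linear_Im disc_potential_along_arc[OF assms(1,2) x, of \<gamma> j]]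
    show "((\<lambda>\<phi>. Im (disc_potential \<gamma> n k (arc_pt n j \<phi>))) has_vector_derivative 0) (at x)"
      using Re_disc_potential_deriv_odd[OF assms(1,2) x assms(4), of \<gamma>] by (simp add: Im_divide_of_nat del: times_complex.sel)
  qed (intro continuous_intros continuous_on_along_arc continuous_on_disc_potential assms)
  then show ?thesis using Im_disc_potential_center assms by simp
qed

section \<open>Transport of the potentials to the polygon\<close>

lemma has_derivative_Re_within:
  assumes "(f has_field_derivative d) (at z within S)"
  shows "((\<lambda>z. Re (f z)) has_derivative (\<lambda>h. cnj d \<bullet> h)) (at z within S)"
proof -
  have "(\<lambda>h. cnj d \<bullet> h) = (\<lambda>h. Re (d * h))" by (simp add: inner_complex_def fun_eq_iff)
  then show ?thesis
    using has_derivative_Re[OF assms[unfolded has_field_derivative_def]] by simp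
qed

text \<open>The gradient is \<open>cnj (f' z)\<close>. With \<open>d\<close> the derivative of
  \<open>f'\<close>, the two pure second derivatives are \<open>Re d\<close> and
  \<open>- Re d\<close>.\<close>

lemma harmonic_on_Re:
  assumes S: "open S" and f: "\<And>z. z \<in> S \<Longrightarrow> (f has_field_derivative f' z) (at z)"
  shows "harmonic_on S (\<lambda>z. Re (f z))"
proof -
  have "f holomorphic_on S"
    using f by (auto simp: holomorphic_on_def field_differentiable_def intro: has_field_derivative_at_within)
  then have "deriv f holomorphic_on S" using S by (rule holomorphic_deriv)
  moreover have "deriv f z = f' z" if "z \<in> S" for z using f[OF that] by (rule DERIV_imp_deriv)
  ultimately have hol: "f' holomorphic_on S" by (simp cong: holomorphic_cong)
  define d where "d = deriv f'"
  have d: "(f' has_field_derivative d z) (at z)" if "z \<in> S" for z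
    unfolding d_def by (rule holomorphic_derivI[OF hol S that])
  have dc: "continuous_on S d"
    unfolding d_def by (intro holomorphic_on_imp_continuous_on holomorphic_deriv hol S)
  show ?thesis
    unfolding harmonic_on_def
  proof (intro conjI exI[of _ "\<lambda>z. cnj (f' z)"] exI[of _ "\<lambda>z h. cnj (d z * h)"] ballI S)
    fix z assume z: "z \<in> S"
    show "((\<lambda>z. Re (f z)) has_derivative (\<bullet>) (cnj (f' z))) (at z)"
      by (rule has_derivative_Re_within[OF f[OF z]])
    show "((\<lambda>z. cnj (f' z)) has_derivative (\<lambda>h. cnj (d z * h))) (at z)"
      using d[OF z] unfolding has_field_derivative_def by (rule has_derivative_cnj)
  qed (auto intro!: continuous_intros dc)
qed

definition potential :: "complex \<Rightarrow> nat \<Rightarrow> nat \<Rightarrow> complex \<Rightarrow> complex" where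
  "potential \<gamma> n k z = disc_potential \<gamma> n k (sc_inv n z)"

definition potential_deriv :: "complex \<Rightarrow> nat \<Rightarrow> nat \<Rightarrow> complex \<Rightarrow> complex" where
  "potential_deriv \<gamma> n k z = disc_potential_deriv \<gamma> n k (sc_inv n z) / sc_map_deriv n (sc_inv n z)"

lemma continuous_on_potential:
  assumes "n \<ge> 2" "0 < k" "k < n"
  shows "continuous_on (polygon n) (potential \<gamma> n k)"
  unfolding potential_def[abs_def]
  by (rule continuous_on_compose2[OF continuous_on_disc_potential continuous_on_sc_inv])
     (use assms sc_inv_in_cball in auto)

lemma has_field_derivative_potential:
  assumes n: "n \<ge> 2" and k: "0 < k" "k < n" and w: "w \<in> cball 0 1" "w ^ (2 * n) \<noteq> -1"
  shows "(potential \<gamma> n k has_field_derivative potential_deriv \<gamma> n k (sc_map n w)) (at (sc_map n w) within polygon n)"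
proof -
  have eq: "sc_inv n (sc_map n w) = w" by (rule sc_inv_sc_map[OF n w(1)])
  have "sc_inv n ` polygon n \<subseteq> cball 0 1" using sc_inv_in_cball[OF n] by blast
  then have "(disc_potential \<gamma> n k has_field_derivative disc_potential_deriv \<gamma> n k w)
      (at (sc_inv n (sc_map n w)) within sc_inv n ` polygon n)"
    unfolding eq by (rule has_field_derivative_subset[OF has_field_derivative_disc_potential[OF k w]])
  from DERIV_image_chain[OF this has_field_derivative_sc_inv[OF n w]]
  show ?thesis unfolding potential_def[abs_def] potential_deriv_def eq by (simp add: o_def)
qed

lemma open_side_preimage:
  assumes "n \<ge> 2" "j \<ge> 1" "z \<in> open_side n j"
  obtains \<phi> where "\<bar>\<phi>\<bar> < pi / 2" "z = sc_map n (arc_pt n j \<phi>)"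
proof -
  obtain t where t: "0 < t" "t < 1" "z = out_normal n j * (1 + \<i> * of_real ((2 * t - 1) * half_side n))"
    using assms(3) unfolding mem_open_side_iff[OF assms(1)] by auto
  from side_point_preimage[OF assms(1,2), of t] t obtain \<phi> where
    "\<bar>\<phi>\<bar> < pi / 2" "sc_map n (arc_pt n j \<phi>) = z" by (metis less_imp_le)
  then show ?thesis using that by blast
qed

lemma side_preimage:
  assumes "n \<ge> 2" "j \<ge> 1" "z \<in> side n j"
  obtains \<phi> where "\<bar>\<phi>\<bar> \<le> pi / 2" "z = sc_map n (arc_pt n j \<phi>)"
proof -
  obtain t where t: "0 \<le> t" "t \<le> 1" "z = out_normal n j * (1 + \<i> * of_real ((2 * t - 1) * half_side n))"
    using assms(3) unfolding mem_side_iff[OF assms(1)] by auto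
  from side_point_preimage[OF assms(1,2) t(1,2)] t(3) that show ?thesis by metis
qed

lemma has_field_derivative_potential_open_side:
  assumes "n \<ge> 2" "0 < k" "k < n" "j \<ge> 1" "z \<in> open_side n j"
  shows "(potential \<gamma> n k has_field_derivative potential_deriv \<gamma> n k z) (at z within polygon n)"
proof -
  from open_side_preimage[OF assms(1,4,5)] obtain \<phi> where
    \<phi>: "\<bar>\<phi>\<bar> < pi / 2" "z = sc_map n (arc_pt n j \<phi>)" .
  show ?thesis unfolding \<phi>(2)
    using arc_pt_power_2n_neq[OF _ \<phi>(1)] assms by (intro has_field_derivative_potential) auto
qed

lemma has_field_derivative_potential_interior:
  assumes "n \<ge> 2" "0 < k" "k < n" "z \<in> interior (polygon n)"
  shows "(potential \<gamma> n k has_field_derivative potential_deriv \<gamma> n k z) (at z within polygon n)"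
proof -
  obtain w where w: "norm w < 1" "z = sc_map n w"
    using assms(4) unfolding sc_map_image(1)[OF assms(1), symmetric] by auto
  show ?thesis unfolding w(2)
    using power_2n_neq_interior[OF _ w(1)] w(1) assms by (intro has_field_derivative_potential) auto
qed

text \<open>The outward normal is a positive multiple of \<open>w * sc_map_deriv n w\<close>. The
  derivative of the map cancels, and the normal derivative on the side reduces to the vanishing
  radial derivative on the odd arc.\<close>

lemma potential_deriv_odd_side:
  assumes "n \<ge> 2" "0 < k" "k < n" "j \<ge> 1" "odd j" "z \<in> open_side n j"
  shows "cnj (potential_deriv \<gamma> n k z) \<bullet> out_normal n j = 0"
proof -
  from open_side_preimage[OF assms(1,4,6)] obtain \<phi> where
    \<phi>: "\<bar>\<phi>\<bar> < pi / 2" "z = sc_map n (arc_pt n j \<phi>)" .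
  define w where "w = arc_pt n j \<phi>"
  have w: "w \<in> cball 0 1" "w ^ (2 * n) \<noteq> -1"
    using arc_pt_power_2n_neq[OF _ \<phi>(1)] assms(1) by (auto simp: w_def)
  obtain r where r: "r > 0" "w * sc_map_deriv n w = of_real r * out_normal n j"
    using sc_map_deriv_arc_pt[OF assms(1) \<phi>(1), of j] by (auto simp: w_def)
  have "sc_map_deriv n w \<noteq> 0" by (rule sc_map_deriv_nonzero[OF assms(1) w])
  moreover have "out_normal n j = w * sc_map_deriv n w / of_real r" using r by simp
  ultimately have "potential_deriv \<gamma> n k z * out_normal n j = w * disc_potential_deriv \<gamma> n k w / of_real r"
    unfolding potential_deriv_def \<phi>(2) w_def[symmetric] sc_inv_sc_map[OF assms(1) w(1)] by simp
  then have "Re (potential_deriv \<gamma> n k z * out_normal n j) = 0"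
    using Re_disc_potential_deriv_odd[OF assms(2,3) \<phi>(1) assms(5), of \<gamma>]
    by (simp add: Re_divide_of_real w_def del: times_complex.sel)
  moreover have "cnj (potential_deriv \<gamma> n k z) \<bullet> out_normal n j = Re (potential_deriv \<gamma> n k z * out_normal n j)"
    by (simp add: inner_complex_def)
  ultimately show ?thesis by simp
qed

text \<open>Varying \<open>\<gamma>\<close> realises every real combination of the real and
  imaginary parts of the \<open>k\<close>-th eigenvector as node values, up to a common
  factor.\<close>

lemma mixed_solution_potential:
  assumes n: "n \<ge> 2" and k: "0 < k" "k < n"
  shows "mixed_solution n (\<lambda>j. potential_const n k * Re (\<gamma> * cis (2 * pi * real j * real k / real n)))
    (\<lambda>z. Re (potential \<gamma> n k z)) (\<lambda>z. cnj (potential_deriv \<gamma> n k z))"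
  unfolding mixed_solution_def
proof (intro conjI ballI impI)
  show "continuous_on (polygon n) (\<lambda>z. Re (potential \<gamma> n k z))"
    by (intro continuous_intros continuous_on_potential n k)
  show "harmonic_on (interior (polygon n)) (\<lambda>z. Re (potential \<gamma> n k z))"
  proof (rule harmonic_on_Re[of _ _ "potential_deriv \<gamma> n k"])
    fix z assume "z \<in> interior (polygon n)"
    then show "(potential \<gamma> n k has_field_derivative potential_deriv \<gamma> n k z) (at z)"
      using has_field_derivative_potential_interior[OF n k] at_within_interior by metis
  qed simp
next
  fix j z assume j: "j \<in> {1..n}" and z: "z \<in> side n (2 * j)"
  have "2 * j \<ge> 1" using j by simp
  from side_preimage[OF n this z] obtain \<phi> where
    \<phi>: "\<bar>\<phi>\<bar> \<le> pi / 2" "z = sc_map n (arc_pt n (2 * j) \<phi>)" .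
  have "potential \<gamma> n k z = disc_potential \<gamma> n k (arc_pt n (2 * j) \<phi>)"
    unfolding potential_def \<phi>(2) by (subst sc_inv_sc_map[OF n]) auto
  then show "Re (potential \<gamma> n k z) = potential_const n k * Re (\<gamma> * cis (2 * pi * real j * real k / real n))"
    using Re_disc_potential_even[OF k \<phi>(1), of "2 * j" \<gamma>] by (simp add: mult_ac)
next
  fix z assume "z \<in> interior (polygon n) \<union> (\<Union>j\<in>{1..2 * n}. open_side n j)"
  then show "((\<lambda>z. Re (potential \<gamma> n k z)) has_derivative (\<lambda>h. cnj (potential_deriv \<gamma> n k z) \<bullet> h)) (at z within polygon n)"
    using has_field_derivative_potential_interior[OF n k] has_field_derivative_potential_open_side[OF n k]
    by (intro has_derivative_Re_within) auto
next
  fix j z assume "j \<in> {1..2 * n}" "odd j" "z \<in> open_side n j"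
  then show "cnj (potential_deriv \<gamma> n k z) \<bullet> out_normal n j = 0"
    using potential_deriv_odd_side[OF n k] by simp
qed

section \<open>Currents and eigenvalues\<close>

text \<open>By the Cauchy-Riemann equations the normal derivative of the real part is the tangential
  derivative of the imaginary part, so the flux is an increment of the latter. The vertices occur
  only as ends of the integration interval, where continuity suffices.\<close>

lemma current_has_integral:
  assumes n: "n \<ge> 2" and k: "0 < k" "k < n" and j: "j \<in> {1..n}"
  shows "(current_integrand n (\<lambda>z. cnj (potential_deriv \<gamma> n k z)) j has_integral
    Im (potential \<gamma> n k (polyvert n (Suc (2 * j)))) - Im (potential \<gamma> n k (polyvert n (2 * j)))) {0..1}"
proof -
  let ?a = "polyvert n (2 * j)" and ?b = "polyvert n (Suc (2 * j))" and ?N = "out_normal n (2 * j)"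
  define p where "p = (\<lambda>t. ?a + of_real t * (?b - ?a))"
  have jj: "2 * j \<in> {1..2 * n}" using j by auto
  have pP: "p t \<in> polygon n" if "t \<in> {0..1}" for t
  proof -
    have "p t \<in> side n (2 * j)"
      using that unfolding p_def side_def by (auto simp: in_segment scaleR_conv_of_real algebra_simps)
    then show ?thesis
      using closed_segment_subset[OF polyvert_in_polygon[OF n jj] convex_polygon] by (auto simp: side_def)
  qed
  have pO: "p t \<in> open_side n (2 * j)" if "t \<in> {0<..<1}" for t
    unfolding p_def side_param[OF n] mem_open_side_iff[OF n] using that by blast
  have "((\<lambda>t. cmod (?b - ?a) * (cnj (potential_deriv \<gamma> n k (p t)) \<bullet> ?N)) has_integral
      Im (potential \<gamma> n k (p 1)) - Im (potential \<gamma> n k (p 0))) {0..1}"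
  proof (rule fundamental_theorem_of_calculus_interior)
    show "continuous_on {0..1} (\<lambda>t. Im (potential \<gamma> n k (p t)))"
      by (intro continuous_intros continuous_on_compose2[OF continuous_on_potential[OF n k]])
         (use pP in \<open>auto simp: p_def intro!: continuous_intros\<close>)
    fix t :: real assume t: "t \<in> {0<..<1}"
    have "(p has_vector_derivative (?b - ?a)) (at t within {0<..<1})"
      unfolding p_def by (auto intro!: derivative_eq_intros)
    moreover have "(potential \<gamma> n k has_field_derivative potential_deriv \<gamma> n k (p t)) (at (p t) within p ` {0<..<1})"
      by (rule has_field_derivative_subset[OF has_field_derivative_potential_open_side[OF n k _ pO[OF t]]])
         (use j pP in auto)
    ultimately have "((potential \<gamma> n k \<circ> p) has_vector_derivative (?b - ?a) * potential_deriv \<gamma> n k (p t)) (at t within {0<..<1})"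
      by (rule field_vector_diff_chain_within)
    then have "((\<lambda>t. potential \<gamma> n k (p t)) has_vector_derivative (?b - ?a) * potential_deriv \<gamma> n k (p t)) (at t)"
      using t by (simp add: o_def at_within_open[of t "{0<..<1}"])
    from bounded_linear.has_vector_derivative[OF bounded_linear_Im this]
    have "((\<lambda>t. Im (potential \<gamma> n k (p t))) has_vector_derivative Im ((?b - ?a) * potential_deriv \<gamma> n k (p t))) (at t)" .
    moreover have "cmod (?b - ?a) = 2 * half_side n"
      unfolding polyvert_diff[OF n] using half_side_pos[OF n] by (simp add: norm_mult)
    \<comment> \<open>The side vector is \<open>\<i>\<close> times the normal times its length, and
      \<open>Im (\<i> * x) = Re x\<close>.\<close>
    then have "Im ((?b - ?a) * potential_deriv \<gamma> n k (p t)) = cmod (?b - ?a) * (cnj (potential_deriv \<gamma> n k (p t)) \<bullet> ?N)"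
      unfolding polyvert_diff[OF n] by (simp add: inner_complex_def algebra_simps)
    ultimately show "((\<lambda>t. Im (potential \<gamma> n k (p t))) has_vector_derivative
        cmod (?b - ?a) * (cnj (potential_deriv \<gamma> n k (p t)) \<bullet> ?N)) (at t)" by simp
  qed simp
  moreover have "p 1 = ?b" "p 0 = ?a" by (simp_all add: p_def)
  ultimately show ?thesis by (simp add: current_integrand_def[abs_def] Let_def p_def)
qed

text \<open>A vertex of an even side is also an end of the adjacent odd arc, where the imaginary
  part equals its value at the arc centre; hence the shifts to \<open>j - 1\<close> and
  \<open>j + 1\<close>.\<close>

lemma potential_polyvert:
  assumes n: "n \<ge> 2" and k: "0 < k" "k < n" and j: "even j" "j \<ge> 2"
  shows "Im (potential \<gamma> n k (polyvert n j)) =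
      potential_const n k * Im (\<gamma> * cis (pi * (real j - 1) * real k / real n))"
    and "Im (potential \<gamma> n k (polyvert n (Suc j))) =
      potential_const n k * Im (\<gamma> * cis (pi * (real j + 1) * real k / real n))"
proof -
  obtain i where ji: "j = Suc i" using j(2) by (cases j) auto
  have "polyvert n j = sc_map n (arc_pt n i (pi / 2))"
    using sc_map_arc_pt[OF n, of "- (pi / 2)" j] arc_height_shared_endpoint(2)[OF n, of i]
    by (simp add: ji polyvert_eq[OF n, of "Suc i"] arc_pt_shared_endpoint)
  then have "potential \<gamma> n k (polyvert n j) = disc_potential \<gamma> n k (arc_pt n i (pi / 2))"
    by (simp add: potential_def sc_inv_sc_map[OF n])
  moreover have "odd i" using j(1) ji by simp
  ultimately show "Im (potential \<gamma> n k (polyvert n j)) =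
      potential_const n k * Im (\<gamma> * cis (pi * (real j - 1) * real k / real n))"
    using Im_disc_potential_odd[OF k, of "pi / 2" i \<gamma>] by (simp add: ji)
  have "polyvert n (Suc j) = sc_map n (arc_pt n (Suc j) (- (pi / 2)))"
    using sc_map_arc_pt[OF n, of "- (pi / 2)" "Suc j"] arc_height_shared_endpoint(2)[OF n, of j]
    by (simp add: polyvert_eq[OF n, of "Suc j"])
  then have "potential \<gamma> n k (polyvert n (Suc j)) = disc_potential \<gamma> n k (arc_pt n (Suc j) (- (pi / 2)))"
    by (simp add: potential_def sc_inv_sc_map[OF n])
  then show "Im (potential \<gamma> n k (polyvert n (Suc j))) =
      potential_const n k * Im (\<gamma> * cis (pi * (real j + 1) * real k / real n))"
    using Im_disc_potential_odd[OF k, of "- (pi / 2)" "Suc j" \<gamma>] j(1) by (simp add: add.commute)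
qed

text \<open>Applied with \<open>y = pi * k / n\<close>, half the angle between consecutive
  components of the eigenvector; the factor \<open>2 * sin y\<close> is the eigenvalue.\<close>

lemma Im_mult_cis_diff:
  "Im (\<gamma> * cis (x + y)) - Im (\<gamma> * cis (x - y)) = 2 * sin y * Re (\<gamma> * cis x)"
  by (simp add: cos_add cos_diff sin_add sin_diff algebra_simps)

text \<open>Node values in \<open>response_matrix\<close> are real, hence the real parts. Potentials
  and currents carry the same positive factor \<open>potential_const n k\<close>, which
  cancels.\<close>

lemma response_matrix_Re:
  assumes n: "n \<ge> 2" and k: "0 < k" "k < n" and j: "j \<in> {1..n}" and Lam: "response_matrix n Lam"
  shows "(\<Sum>l=1..n. Lam j l * of_real (Re (\<gamma> * cis (2 * pi * real l * real k / real n)))) =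
    of_real (2 * sin (pi * real k / real n) * Re (\<gamma> * cis (2 * pi * real j * real k / real n)))"
proof -
  let ?C = "potential_const n k"
  let ?r = "\<lambda>l. Re (\<gamma> * cis (2 * pi * real l * real k / real n))"
  obtain I where I: "(current_integrand n (\<lambda>z. cnj (potential_deriv \<gamma> n k z)) j has_integral I) {0..1}"
      "(\<Sum>l=1..n. Lam j l * of_real (?C * ?r l)) = of_real I"
    using Lam mixed_solution_potential[OF n k, of \<gamma>] j unfolding response_matrix_def by blast
  have jj: "even (2 * j)" "2 * j \<ge> 2" using j by auto
  have "I = Im (potential \<gamma> n k (polyvert n (Suc (2 * j)))) - Im (potential \<gamma> n k (polyvert n (2 * j)))"
    by (rule has_integral_unique[OF I(1) current_has_integral[OF n k j]])
  also have "\<dots> = ?C * (Im (\<gamma> * cis (2 * pi * real j * real k / real n + pi * real k / real n)) -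
      Im (\<gamma> * cis (2 * pi * real j * real k / real n - pi * real k / real n)))"
    unfolding potential_polyvert[OF n k jj] right_diff_distrib
    by (intro arg_cong2[where f = "(-)"] arg_cong[where f = "\<lambda>x. ?C * Im (\<gamma> * cis x)"])
       (simp_all add: algebra_simps add_divide_distrib diff_divide_distrib)
  also have "\<dots> = ?C * (2 * sin (pi * real k / real n) * ?r j)"
    unfolding Im_mult_cis_diff ..
  finally have "of_real ?C * (\<Sum>l=1..n. Lam j l * of_real (?r l)) =
      of_real ?C * (of_real (2 * sin (pi * real k / real n) * ?r j) :: complex)"
    using I(2) by (simp only: of_real_mult sum_distrib_left mult_ac)
  moreover have "complex_of_real ?C \<noteq> 0" using potential_const_pos[OF k] by simp
  ultimately show ?thesis by (simp only: mult_cancel_left simp_thms)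
qed

text \<open>This serves \<open>k = n\<close>, where the eigenvector is constant and the eigenvalue
  \<open>2 * sin pi\<close> is 0; the disc potential would there involve the exponent
  \<open>n - k = 0\<close>, outside the range of the primitives.\<close>

lemma mixed_solution_const: "mixed_solution n (\<lambda>_. c) (\<lambda>_. c) (\<lambda>_. 0)"
  unfolding mixed_solution_def harmonic_on_def
  by (auto simp: has_derivative_const inner_zero_left[abs_def] intro!: exI[of _ "\<lambda>_. 0"] exI[of _ "\<lambda>_ _. 0"])

lemma response_matrix_row_sum:
  assumes "j \<in> {1..n}" "response_matrix n Lam"
  shows "(\<Sum>l=1..n. Lam j l) = 0"
proof -
  obtain I where I: "(current_integrand n (\<lambda>_. 0) j has_integral I) {0..1}"
      "(\<Sum>l=1..n. Lam j l * of_real 1) = of_real I"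
    using assms mixed_solution_const[of n 1] unfolding response_matrix_def by blast
  have "current_integrand n (\<lambda>_. 0) j = (\<lambda>_. 0)" by (simp add: current_integrand_def[abs_def])
  then have "I = 0" using I(1) has_integral_0 has_integral_unique by metis
  then show ?thesis using I(2) by simp
qed

theorem theorem2:
  fixes n :: nat and Lam :: "nat \<Rightarrow> nat \<Rightarrow> complex"
  assumes "n \<ge> 2"
    and "response_matrix n Lam"
  defines "W \<equiv> (\<lambda>j k. cis (2 * pi * real j * real k / real n))"
    and "D \<equiv> (\<lambda>j k. if j = k then complex_of_real (2 * sin (pi * real k / real n)) else 0)"
  shows "\<forall>j\<in>{1..n}. \<forall>k\<in>{1..n}.
           (\<Sum>l=1..n. Lam j l * W l k) = (\<Sum>l=1..n. W j l * D l k)"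
proof (intro ballI)
  fix j k assume j: "j \<in> {1..n}" and k: "k \<in> {1..n}"
  let ?s = "2 * sin (pi * real k / real n)"
  have rhs: "(\<Sum>l=1..n. W j l * D l k) = of_real ?s * W j k"
    using k by (simp add: D_def if_distrib[of "\<lambda>x. _ * x"] sum.delta mult.commute cong: if_cong)
  have "(\<Sum>l=1..n. Lam j l * W l k) = of_real ?s * W j k"
  proof (cases "k = n")
    case True
    have "W l k = 1" for l
      using assms(1) cis_multiple_2pi[of "real l"] by (simp add: W_def True)
    then show ?thesis
      using assms(1) response_matrix_row_sum[OF j assms(2)] by (simp add: True)
  next
    case False
    then have kn: "0 < k" "k < n" using k by auto
    \<comment> \<open>As \<open>Re (- \<i> * x) = Im x\<close>, the parameters \<open>1\<close> and
      \<open>- \<i>\<close> recover the complex column from two real node vectors.\<close>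
    have W: "W l k = of_real (Re (1 * W l k)) + \<i> * of_real (Re (- \<i> * W l k))" for l
      by (simp add: complex_eq_iff)
    have "(\<Sum>l=1..n. Lam j l * W l k) =
        (\<Sum>l=1..n. Lam j l * of_real (Re (1 * W l k))) + \<i> * (\<Sum>l=1..n. Lam j l * of_real (Re (- \<i> * W l k)))"
      unfolding sum_distrib_left sum.distrib[symmetric]
      by (intro sum.cong refl, subst W) (simp add: algebra_simps)
    also have "\<dots> = of_real (?s * Re (1 * W j k)) + \<i> * of_real (?s * Re (- \<i> * W j k))"
      unfolding W_def response_matrix_Re[OF assms(1) kn j assms(2)] ..
    also have "\<dots> = of_real ?s * W j k"
      by (subst (3) W) (simp add: algebra_simps)
    finally show ?thesis .
  qed
  with rhs show "(\<Sum>l=1..n. Lam j l * W l k) = (\<Sum>l=1..n. W j l * D l k)" by simp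
qed

end
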